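(* Let $\mathcal{L}$ be a finite nonempty list and let $\{\Psi^l:\mathcal{B}^l\to\mathbb{R}\}_{l\in\mathcal{L}}$ be a family of quasiconcave functionals, where the sets $\mathcal{B}^l\subset\mathbb{R}^m$ are convex for all $l\in\mathcal{L}$. Let $\mathcal{B}:=\{U\in\bigcap_{l\in\mathcal{L}}\mathcal{B}^l : \Psi^l(U)\ge 0,\ \forall l\in\mathcal{L}\}$ and assume that $\mathcal{B}$ is an invariant set for $\partial_t u+\nabla\cdot f(u)=S(u)$, with associated constant $\tau_0>0$. Let $n\ge 0$ and assume that $\min_{i\in\mathcal{V}}\big(1+4\Delta t\,\frac{d_{ii}^{L,n}}{m_i}\big)\ge 0$ and $2\Delta t\le\tau_0$. For $i\in\mathcal{V}$, $l\in\mathcal{L}$ set $$\Psi_i^{l,\min}:=\min\Big(\Psi^l\big(U_i^n+2\Delta t\,S(U_i^n)\big),\ \min_{j\in\mathcal{I}(i)}\Psi^l(\overline{U}_{ij}^n)\Big),\qquad \Psi_i^l(U):=\Psi^l(U)-\Psi_i^{l,\min}.$$ For $i\in\mathcal{V}$, $j\in\mathcal{I}(i)\setminus\{i\}$, $l\in\mathcal{L}$, let $\ell_j^{i,l}:=1$ if $\Psi_i^l(U_i^{L,n+1}+P_{ij}^n)\ge 0$ and $\ell_j^{i,l}:=\max\{\ell\in[0,1]:\Psi_i^l(U_i^{L,n+1}+\ell P_{ij}^n)\ge 0\}$ otherwise. Let $\ell_{ij}:=\min\big(\min_{l\in\mathcal{L}}\ell_j^{i,l},\ \min_{l\in\mathcal{L}}\ell_i^{j,l}\big)$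 and let $$U_i^{n+1}:=\sum_{j\in\mathcal{I}(i)\setminus\{i\}}\lambda_j\,(U_i^{L,n+1}+\ell_{ij}P_{ij}^n),\qquad i\in\mathcal{V}.$$ Then $\mathcal{B}$ is an invariant domain for the map $(U_i^n)_{i\in\mathcal V}\mapsto(U_i^{n+1})_{i\in\mathcal V}$, i.e. $$\big(U_i^n\in\mathcal{B},\ \forall i\in\mathcal{V}\big)\ \Rightarrow\ \big(U_i^{n+1}\in\mathcal{B},\ \forall i\in\mathcal{V}\big).$$
   Context: Hyperbolic system. $\mathcal{A}\subset\mathbb{R}^m$ is a nonempty admissible set, $f:\mathcal{A}\to\mathbb{R}^{m\times d}$ a flux, $S:\mathcal{A}\to\mathbb{R}^m$ a source. For all $v_L,v_R\in\mathcal{A}$ and every unit vector $n\in\mathbb{R}^d$, the Riemann problem $\partial_t v+\partial_x(f(v)n)=0$, $v(x,0)=v_L$ for $x<0$, $v(x,0)=v_R$ for $x>0$, is assumed to have a unique entropy-satisfying self-similar weak solution $v(n,v_L,v_R,\xi)$, $\xi=x/t$, and a maximum wave speed $\lambda_{\max}(n,v_L,v_R)$ such that this solution equals $v_L$ if $\xi\le-\lambda_{\max}(n,v_L,v_R)$ and $v_R$ if $\xi\ge\lambda_{\max}(n,v_L,v_R)$. The average over the Riemann fan is $\overline{v}(t,n,v_L,v_R):=\int_{-1/2}^{1/2}v(n,v_L,v_R,x/t)\,dx$; recall that if $t\lambda_{\max}(n,v_L,v_R)\le\frac12$ then $\overline{v}(t,n,v_L,v_R)=\frac12(v_L+v_R)-t\,(f(v_R)n-f(v_L)n)$.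 Invariant set. $\mathcal{B}\subset\mathcal{A}$ is an invariant set (for the system with source) if it is convex, if for all $v_L,v_R\in\mathcal{B}$, all unit vectors $n$ and all $t>0$ with $t\lambda_{\max}(n,v_L,v_R)\le\frac12$ one has $\overline{v}(t,n,v_L,v_R)\in\mathcal{B}$, and if there is $\tau_0>0$ such that $U+\tau S(U)\in\mathcal{B}$ for all $U\in\mathcal{B}$ and all $\tau\in[0,\tau_0]$. Low-order scheme. $\mathcal{V}$ is a finite index set; for each $i\in\mathcal{V}$, $\mathcal{I}(i)\subset\mathcal{V}$ contains $i$, and $j\in\mathcal{I}(i)$ iff $i\in\mathcal{I}(j)$. $m_i>0$; $c_{ij}\in\mathbb{R}^d$ satisfy $c_{ij}=-c_{ji}$ and $\sum_{j\in\mathcal{I}(i)}c_{ij}=0$. $\Delta t>0$ is the time step and $U_i^n\in\mathcal{A}$. With $n_{ij}:=c_{ij}/\|c_{ij}\|_{\ell^2}$, for $j\ne i$, $$d_{ij}^{L,n}:=\max\big(\lambda_{\max}(n_{ij},U_i^n,U_j^n)\|c_{ij}\|_{\ell^2},\ \lambda_{\max}(n_{ji},U_j^n,U_i^n)\|c_{ji}\|_{\ell^2}\big),$$ assumed $>0$ (in particular $c_{ij}\neq0$), and $d_{ii}^{L,n}:=-\sum_{j\in\mathcal{I}(i)\setminus\{i\}}d_{ij}^{L,n}$. The low-order update $U_i^{L,n+1}$ is defined by $$\tfrac{m_i}{\Delta t}(U_i^{L,n+1}-U_i^n)+\sum_{j\in\mathcal{I}(i)}f(U_j^n)c_{ij}-\sum_{j\in\mathcal{I}(i)\setminus\{i\}}d_{ij}^{L,n}(U_j^n-U_i^n)=m_iS(U_i^n).$$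 Auxiliary states: $\overline{U}_{ij}^n:=\frac12(U_i^n+U_j^n)-(f(U_j^n)-f(U_i^n))\frac{c_{ij}}{2d_{ij}^{L,n}}$ for $j\ne i$, and $\overline{U}_{ii}^n:=U_i^n$. High-order update and limiting. A high-order update $U_i^{H,n+1}$ is given by $\frac{m_i}{\Delta t}(U_i^{H,n+1}-U_i^n)+\sum_{j\in\mathcal{I}(i)}F_{ij}^{H,n}=m_iS(U_i^n)$ with some skew-symmetric fluxes $F_{ij}^{H,n}=-F_{ji}^{H,n}\in\mathbb{R}^m$. Set $F_{ij}^{L,n}:=(f(U_j^n)+f(U_i^n))c_{ij}-d_{ij}^{L,n}(U_j^n-U_i^n)$, $A_{ij}^n:=\Delta t(F_{ij}^{L,n}-F_{ij}^{H,n})$, so that $m_iU_i^{H,n+1}=m_iU_i^{L,n+1}+\sum_{j\in\mathcal{I}(i)\setminus\{i\}}A_{ij}^n$. For each $i$, $\{\lambda_j\}_{j\in\mathcal{I}(i)\setminus\{i\}}$ are strictly positive numbers with sum $1$ (they may depend on $i$), and $P_{ij}^n:=\frac{1}{m_i\lambda_j}A_{ij}^n$. Quasiconcavity. For a convex set $\mathcal{C}\subset\mathbb{R}^m$, $\Psi:\mathcal{C}\to\mathbb{R}$ is quasiconcave if $\{U\in\mathcal{C}:\Psi(U)\ge\chi\}$ is convex for every $\chi\in\mathbb{R}$. An inequality $\Psi_i^l(V)\ge0$ means $V\in\mathcal{B}^l$ and $\Psi_i^l(V)\ge0$; the maxima defining $\ell_j^{i,l}$ are assumed to be attained. *)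

theory Defs
  imports "HOL-Analysis.Analysis"
begin

subsection \<open>Riemann problems\<close>

text \<open>
  States live in \<open>real ^ 'm\<close>, space in \<open>real ^ 'd\<close>, and the flux takes values in the
  m-by-d matrices \<open>real ^ 'd ^ 'm\<close>, so that \<open>f v *v n\<close> is the flux in direction \<open>n\<close>.
  Functions on the admissible set are represented by total functions that are only used there.
  Points of \<open>real \<times> real\<close> are pairs \<open>(x, t)\<close>.
\<close>

abbreviation half_plane :: "(real \<times> real) set" where
  "half_plane \<equiv> UNIV \<times> {0<..}"

definition locally_integrable :: "(real \<times> real \<Rightarrow> 'b::{banach, second_countable_topology}) \<Rightarrow> bool" where
  "locally_integrable g \<longleftrightarrow>
     (\<forall>K. compact K \<longrightarrow> set_integrable lborel (K \<inter> half_plane) g)"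

text \<open>
  Continuously differentiable \<open>\<phi>\<close> with compact support, with partial derivatives \<open>\<phi>x\<close> and
  \<open>\<phi>t\<close>. The support may meet the line \<open>t = 0\<close>, so that the restriction to \<open>t \<ge> 0\<close> also sees
  the initial data.
\<close>

definition test_function ::
  "(real \<times> real \<Rightarrow> real) \<Rightarrow> (real \<times> real \<Rightarrow> real) \<Rightarrow> (real \<times> real \<Rightarrow> real) \<Rightarrow> bool" where
  "test_function \<phi> \<phi>x \<phi>t \<longleftrightarrow>
     (\<forall>p. (\<phi> has_derivative (\<lambda>h. \<phi>x p * fst h + \<phi>t p * snd h)) (at p)) \<and>
     continuous_on UNIV \<phi>x \<and> continuous_on UNIV \<phi>t \<and>
     (\<exists>K. compact K \<and> (\<forall>p. p \<notin> K \<longrightarrow> \<phi> p = 0))"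

text \<open>
  The space-time integrals obtained by testing \<open>\<partial>\<^sub>t a + \<partial>\<^sub>x b\<close> with \<open>\<phi>\<close> and integrating by parts,
  where \<open>a\<close> has the initial values \<open>a0\<close>.
\<close>

definition weak_form ::
  "(real \<times> real \<Rightarrow> 'b::{banach, second_countable_topology}) \<Rightarrow> (real \<times> real \<Rightarrow> 'b) \<Rightarrow>
   (real \<Rightarrow> 'b) \<Rightarrow>
   (real \<times> real \<Rightarrow> real) \<Rightarrow> (real \<times> real \<Rightarrow> real) \<Rightarrow> (real \<times> real \<Rightarrow> real) \<Rightarrow> 'b" where
  "weak_form a b a0 \<phi> \<phi>x \<phi>t =
     (LINT p:half_plane|lborel. \<phi>t p *\<^sub>R a p + \<phi>x p *\<^sub>R b p) +
     (LINT x|lborel. \<phi> (x, 0) *\<^sub>R a0 x)"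

definition weak_solution ::
  "(real ^ 'm \<Rightarrow> real ^ 'm) \<Rightarrow> (real \<Rightarrow> real ^ 'm) \<Rightarrow> (real \<times> real \<Rightarrow> real ^ 'm) \<Rightarrow> bool" where
  "weak_solution g u0 u \<longleftrightarrow>
     locally_integrable u \<and> locally_integrable (\<lambda>p. g (u p)) \<and>
     (\<forall>\<phi> \<phi>x \<phi>t. test_function \<phi> \<phi>x \<phi>t \<longrightarrow>
        weak_form u (\<lambda>p. g (u p)) u0 \<phi> \<phi>x \<phi>t = 0)"

text \<open>
  Convex entropy \<open>\<eta>\<close> with entropy flux \<open>q\<close>: for every direction \<open>n\<close> and increment \<open>h\<close> the
  derivative of \<open>q \<bullet> n\<close> is that of \<open>\<eta>\<close> composed with that of \<open>f n\<close>. As \<open>A\<close> need not be convex,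
  convexity of \<open>\<eta>\<close> is required on the convex subsets of \<open>A\<close>.
\<close>

definition entropy_pair ::
  "(real ^ 'm) set \<Rightarrow> (real ^ 'm \<Rightarrow> real ^ 'd ^ 'm) \<Rightarrow>
   (real ^ 'm \<Rightarrow> real) \<Rightarrow> (real ^ 'm \<Rightarrow> real ^ 'd) \<Rightarrow> bool" where
  "entropy_pair A f \<eta> q \<longleftrightarrow>
     (\<forall>C. C \<subseteq> A \<and> convex C \<longrightarrow> convex_on C \<eta>) \<and>
     (\<forall>u\<in>A. \<exists>D\<eta> Dq Df.
        (\<eta> has_derivative D\<eta>) (at u within A) \<and>
        (q has_derivative Dq) (at u within A) \<and>
        (f has_derivative Df) (at u within A) \<and>
        (\<forall>h n. Dq h \<bullet> n = D\<eta> (Df h *v n)))"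

text \<open>The entropy inequality \<open>\<partial>\<^sub>t \<eta>(u) + \<partial>\<^sub>x (q(u) \<bullet> n) \<le> 0\<close> in the weak sense.\<close>

definition entropy_inequality ::
  "real ^ 'd \<Rightarrow> (real ^ 'm \<Rightarrow> real) \<Rightarrow> (real ^ 'm \<Rightarrow> real ^ 'd) \<Rightarrow>
   (real \<Rightarrow> real ^ 'm) \<Rightarrow> (real \<times> real \<Rightarrow> real ^ 'm) \<Rightarrow> bool" where
  "entropy_inequality n \<eta> q u0 u \<longleftrightarrow>
     locally_integrable (\<lambda>p. \<eta> (u p)) \<and> locally_integrable (\<lambda>p. q (u p) \<bullet> n) \<and>
     (\<forall>\<phi> \<phi>x \<phi>t. test_function \<phi> \<phi>x \<phi>t \<and> (\<forall>p. \<phi> p \<ge> 0) \<longrightarrow>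
        weak_form (\<lambda>p. \<eta> (u p)) (\<lambda>p. q (u p) \<bullet> n) (\<lambda>x. \<eta> (u0 x)) \<phi> \<phi>x \<phi>t \<ge> 0)"

definition riemann_data :: "real ^ 'm \<Rightarrow> real ^ 'm \<Rightarrow> real \<Rightarrow> real ^ 'm" where
  "riemann_data vL vR x = (if x < 0 then vL else vR)"

text \<open>
  \<open>w\<close> is the profile, as a function of \<open>\<xi> = x / t\<close>, of a self-similar weak solution of the Riemann
  problem in direction \<open>n\<close> that satisfies the entropy inequalities for all the entropy pairs
  in \<open>E\<close>.
\<close>

definition riemann_solution ::
  "(real ^ 'm) set \<Rightarrow> (real ^ 'm \<Rightarrow> real ^ 'd ^ 'm) \<Rightarrow>
   ((real ^ 'm \<Rightarrow> real) \<times> (real ^ 'm \<Rightarrow> real ^ 'd)) set \<Rightarrow>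
   real ^ 'd \<Rightarrow> real ^ 'm \<Rightarrow> real ^ 'm \<Rightarrow> (real \<Rightarrow> real ^ 'm) \<Rightarrow> bool" where
  "riemann_solution A f E n vL vR w \<longleftrightarrow>
     (\<forall>\<xi>. w \<xi> \<in> A) \<and>
     weak_solution (\<lambda>u. f u *v n) (riemann_data vL vR) (\<lambda>(x, t). w (x / t)) \<and>
     (\<forall>(\<eta>, q)\<in>E. entropy_inequality n \<eta> q (riemann_data vL vR) (\<lambda>(x, t). w (x / t)))"

text \<open>
  Standing assumptions on the system: \<open>v n vL vR\<close> is the unique entropy solution and
  \<open>lmax n vL vR\<close> bounds its wave speeds. Solutions are identified when they agree almost
  everywhere; in particular \<open>lmax n vL vR = 0\<close> is possible for a stationary jump.
\<close>

definition hyperbolic_system ::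
  "(real ^ 'm) set \<Rightarrow> (real ^ 'm \<Rightarrow> real ^ 'd ^ 'm) \<Rightarrow>
   ((real ^ 'm \<Rightarrow> real) \<times> (real ^ 'm \<Rightarrow> real ^ 'd)) set \<Rightarrow>
   (real ^ 'd \<Rightarrow> real ^ 'm \<Rightarrow> real ^ 'm \<Rightarrow> real \<Rightarrow> real ^ 'm) \<Rightarrow>
   (real ^ 'd \<Rightarrow> real ^ 'm \<Rightarrow> real ^ 'm \<Rightarrow> real) \<Rightarrow> bool" where
  "hyperbolic_system A f E v lmax \<longleftrightarrow>
     A \<noteq> {} \<and>
     (\<forall>(\<eta>, q)\<in>E. entropy_pair A f \<eta> q) \<and>
     (\<forall>vL\<in>A. \<forall>vR\<in>A. \<forall>n. norm n = 1 \<longrightarrow>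
        riemann_solution A f E n vL vR (v n vL vR) \<and>
        (\<forall>w. riemann_solution A f E n vL vR w \<longrightarrow> (AE \<xi> in lborel. w \<xi> = v n vL vR \<xi>)) \<and>
        (AE \<xi> in lborel. \<xi> \<le> - lmax n vL vR \<longrightarrow> v n vL vR \<xi> = vL) \<and>
        (AE \<xi> in lborel. \<xi> \<ge> lmax n vL vR \<longrightarrow> v n vL vR \<xi> = vR))"

definition riemann_average ::
  "(real ^ 'd \<Rightarrow> real ^ 'm \<Rightarrow> real ^ 'm \<Rightarrow> real \<Rightarrow> real ^ 'm) \<Rightarrow>
   real \<Rightarrow> real ^ 'd \<Rightarrow> real ^ 'm \<Rightarrow> real ^ 'm \<Rightarrow> real ^ 'm" where
  "riemann_average v t n vL vR = (LINT x:{-1/2..1/2}|lborel. v n vL vR (x / t))"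


subsection \<open>Invariant sets and quasiconcavity\<close>

definition invariant_set ::
  "(real ^ 'm) set \<Rightarrow> (real ^ 'd \<Rightarrow> real ^ 'm \<Rightarrow> real ^ 'm \<Rightarrow> real \<Rightarrow> real ^ 'm) \<Rightarrow>
   (real ^ 'd \<Rightarrow> real ^ 'm \<Rightarrow> real ^ 'm \<Rightarrow> real) \<Rightarrow> (real ^ 'm \<Rightarrow> real ^ 'm) \<Rightarrow>
   real \<Rightarrow> (real ^ 'm) set \<Rightarrow> bool" where
  "invariant_set A v lmax S \<tau>0 B \<longleftrightarrow>
     B \<subseteq> A \<and> convex B \<and>
     (\<forall>vL\<in>B. \<forall>vR\<in>B. \<forall>n t. norm n = 1 \<and> t > 0 \<and> t * lmax n vL vR \<le> 1/2 \<longrightarrow>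
        riemann_average v t n vL vR \<in> B) \<and>
     \<tau>0 > 0 \<and> (\<forall>u\<in>B. \<forall>\<tau>\<in>{0..\<tau>0}. u + \<tau> *\<^sub>R S u \<in> B)"

definition quasiconcave_on :: "'b::real_vector set \<Rightarrow> ('b \<Rightarrow> real) \<Rightarrow> bool" where
  "quasiconcave_on C \<Psi> \<longleftrightarrow> convex C \<and> (\<forall>r. convex {u \<in> C. \<Psi> u \<ge> r})"


subsection \<open>The scheme\<close>

text \<open>
  \<open>N i\<close> is the stencil of \<open>i\<close> (it contains \<open>i\<close>), \<open>c\<close> the discrete gradient coefficients and \<open>U\<close>
  the current states. The diagonal value makes the rows over the stencil sum to zero.
\<close>

definition low_viscosity ::
  "(real ^ 'd \<Rightarrow> real ^ 'm \<Rightarrow> real ^ 'm \<Rightarrow> real) \<Rightarrow> ('i \<Rightarrow> 'i set) \<Rightarrow>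
   ('i \<Rightarrow> 'i \<Rightarrow> real ^ 'd) \<Rightarrow> ('i \<Rightarrow> real ^ 'm) \<Rightarrow> 'i \<Rightarrow> 'i \<Rightarrow> real" where
  "low_viscosity lmax N c U i j =
     (let nrm = (\<lambda>k l. c k l /\<^sub>R norm (c k l));
          e = (\<lambda>k l. max (lmax (nrm k l) (U k) (U l) * norm (c k l))
                          (lmax (nrm l k) (U l) (U k) * norm (c l k)))
      in if j = i then - (\<Sum>k\<in>N i - {i}. e i k) else e i j)"

definition bar_state ::
  "(real ^ 'm \<Rightarrow> real ^ 'd ^ 'm) \<Rightarrow> ('i \<Rightarrow> 'i \<Rightarrow> real) \<Rightarrow> ('i \<Rightarrow> 'i \<Rightarrow> real ^ 'd) \<Rightarrow>
   ('i \<Rightarrow> real ^ 'm) \<Rightarrow> 'i \<Rightarrow> 'i \<Rightarrow> real ^ 'm" where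
  "bar_state f d c U i j =
     (if j = i then U i
      else (1/2) *\<^sub>R (U i + U j) - (f (U j) - f (U i)) *v (c i j /\<^sub>R (2 * d i j)))"

definition low_flux ::
  "(real ^ 'm \<Rightarrow> real ^ 'd ^ 'm) \<Rightarrow> ('i \<Rightarrow> 'i \<Rightarrow> real) \<Rightarrow> ('i \<Rightarrow> 'i \<Rightarrow> real ^ 'd) \<Rightarrow>
   ('i \<Rightarrow> real ^ 'm) \<Rightarrow> 'i \<Rightarrow> 'i \<Rightarrow> real ^ 'm" where
  "low_flux f d c U i j = (f (U j) + f (U i)) *v c i j - d i j *\<^sub>R (U j - U i)"

definition local_min ::
  "(real ^ 'm \<Rightarrow> real ^ 'd ^ 'm) \<Rightarrow> (real ^ 'm \<Rightarrow> real ^ 'm) \<Rightarrow> ('i \<Rightarrow> 'i set) \<Rightarrow>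
   ('i \<Rightarrow> 'i \<Rightarrow> real) \<Rightarrow> ('i \<Rightarrow> 'i \<Rightarrow> real ^ 'd) \<Rightarrow> real \<Rightarrow> ('i \<Rightarrow> real ^ 'm) \<Rightarrow>
   (real ^ 'm \<Rightarrow> real) \<Rightarrow> 'i \<Rightarrow> real" where
  "local_min f S N d c \<Delta>t U \<Psi> i =
     min (\<Psi> (U i + (2 * \<Delta>t) *\<^sub>R S (U i))) (MIN j\<in>N i. \<Psi> (bar_state f d c U i j))"

text \<open>
  The constraint on a limiter \<open>\<theta>\<close> for the state \<open>W + \<theta> P\<close>: since \<open>\<Psi>\<close> is a function on \<open>C\<close>, an
  inequality for its value includes membership in \<open>C\<close>.
\<close>

definition admissible_limiter ::
  "'b::real_vector set \<Rightarrow> ('b \<Rightarrow> real) \<Rightarrow> real \<Rightarrow> 'b \<Rightarrow> 'b \<Rightarrow> real \<Rightarrow> bool" where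
  "admissible_limiter C \<Psi> \<psi>min W P \<theta> \<longleftrightarrow>
     W + \<theta> *\<^sub>R P \<in> C \<and> \<Psi> (W + \<theta> *\<^sub>R P) - \<psi>min \<ge> 0"

definition limiter_bound ::
  "'b::real_vector set \<Rightarrow> ('b \<Rightarrow> real) \<Rightarrow> real \<Rightarrow> 'b \<Rightarrow> 'b \<Rightarrow> real" where
  "limiter_bound C \<Psi> \<psi>min W P =
     (if admissible_limiter C \<Psi> \<psi>min W P 1 then 1
      else (GREATEST \<theta>. \<theta> \<in> {0..1} \<and> admissible_limiter C \<Psi> \<psi>min W P \<theta>))"

text \<open>The greatest element in the previous definition is specified only if it exists.\<close>

definition limiter_max_attained ::
  "'b::real_vector set \<Rightarrow> ('b \<Rightarrow> real) \<Rightarrow> real \<Rightarrow> 'b \<Rightarrow> 'b \<Rightarrow> bool" where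
  "limiter_max_attained C \<Psi> \<psi>min W P \<longleftrightarrow>
     admissible_limiter C \<Psi> \<psi>min W P 1 \<or>
     (\<exists>\<theta>\<in>{0..1}. admissible_limiter C \<Psi> \<psi>min W P \<theta> \<and>
        (\<forall>\<theta>'\<in>{0..1}. admissible_limiter C \<Psi> \<psi>min W P \<theta>' \<longrightarrow> \<theta>' \<le> \<theta>))"

end

theory Submission
  imports Defs
begin

text \<open>
  The new state is obtained from states in \<open>B\<close> by convex combinations, and by limited corrections
  that respect constraints at least as strict as those defining \<open>B\<close>.

  The bar state of two neighbours is the average of a Riemann solution over its fan, so it lies in
  the invariant set (\<open>bar_state_mem_invariant_set\<close>). That the average has the explicit form
  \<open>(vL + vR) / 2 - t (f vR n - f vL n)\<close> is derived here from the weak formulation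
  (\<open>riemann_average_eq\<close>): a test function that is constant in space on the fan until it is cut off in
  time sees the profile only through its integral and the flux only at the two outer states, so
  testing amounts to integrating the conservation law over the fan (\<open>riemann_fan_integral\<close>).

  Under the time step condition, the low-order update is the midpoint of the source update
  \<open>U i + 2 \<Delta>t S (U i)\<close> and a convex combination of bar states (\<open>low_order_update_mem_convex\<close>). The
  bound \<open>\<psi>min i l\<close> is the smallest value of \<open>\<Psi> l\<close> at exactly these states; hence by quasiconcavity
  the low-order update satisfies \<open>\<Psi> l \<ge> \<psi>min i l\<close>, and as these states are in \<open>B\<close>, \<open>\<psi>min i l \<ge> 0\<close>.

  The limiter 0 is therefore admissible, and by quasiconcavity so is everything between 0 and
  the limiter computed for one side and one functional, in particular the final minimum
  (\<open>admissible_limiter_downward\<close>). The new state is a convex combination of the limited states, and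
  all of them satisfy the constraints \<open>\<Psi> l \<ge> \<psi>min i l \<ge> 0\<close> that put it into \<open>B\<close>.
\<close>

section \<open>A plateau test function\<close>

text \<open>
  A continuously differentiable cutoff that equals 1 on \<open>[-r, r]\<close> and vanishes outside
  \<open>[-(r + 1), r + 1]\<close>: squaring the positive part, applied twice, is just smooth enough for a test
  function and keeps all derivatives explicit. For \<open>r = 0\<close> it is the square of the positive part
  of \<open>1 - x\<^sup>4\<close>.
\<close>

definition bump :: "real \<Rightarrow> real \<Rightarrow> real" where
  "bump r x = (max 0 (1 - (max 0 (x\<^sup>2 - r\<^sup>2))\<^sup>2))\<^sup>2"

definition bump' :: "real \<Rightarrow> real \<Rightarrow> real" where
  "bump' r x = - 8 * x * max 0 (1 - (max 0 (x\<^sup>2 - r\<^sup>2))\<^sup>2) * max 0 (x\<^sup>2 - r\<^sup>2)"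

lemma DERIV_pos_part_square:
  "((\<lambda>x::real. (max 0 x)\<^sup>2) has_real_derivative 2 * max 0 x) (at x)"
proof (cases x "0::real" rule: linorder_cases)
  case less
  show ?thesis
    by (rule has_field_derivative_transform_within_open[where f = "\<lambda>_. 0" and S = "{..<0}"])
       (use less in auto)
next
  case equal
  have "\<forall>\<^sub>F h in at 0. norm ((max 0 h)\<^sup>2 / h) \<le> \<bar>h::real\<bar>"
    by (auto simp: eventually_at_filter power2_eq_square max_def)
  then have "((\<lambda>h::real. (max 0 h)\<^sup>2 / h) \<longlongrightarrow> 0) (at 0)"
    by (rule Lim_null_comparison) (auto intro!: tendsto_eq_intros)
  then show ?thesis
    using equal by (simp add: DERIV_def)
next
  case greater
  show ?thesis
    by (rule has_field_derivative_transform_within_open[where f = "\<lambda>x. x\<^sup>2" and S = "{0<..}"])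
       (use greater in \<open>auto intro!: derivative_eq_intros\<close>)
qed

lemma DERIV_bump: "(bump r has_real_derivative bump' r x) (at x)"
proof -
  have chain: "((\<lambda>x. (max 0 (g x))\<^sup>2) has_real_derivative 2 * max 0 (g x) * g') (at x)"
    if "(g has_real_derivative g') (at x)" for g :: "real \<Rightarrow> real" and g'
    using DERIV_chain2[OF DERIV_pos_part_square that] by simp
  have "((\<lambda>x. x\<^sup>2 - r\<^sup>2) has_real_derivative 2 * x) (at x)"
    by (auto intro!: derivative_eq_intros)
  from DERIV_diff[OF DERIV_const[of 1] chain[OF this]]
  have "((\<lambda>x. 1 - (max 0 (x\<^sup>2 - r\<^sup>2))\<^sup>2) has_real_derivative
      - (2 * max 0 (x\<^sup>2 - r\<^sup>2) * (2 * x))) (at x)"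
    by simp
  from chain[OF this] show ?thesis
    unfolding bump_def[abs_def] bump'_def by (simp add: algebra_simps)
qed

lemma continuous_on_bump': "continuous_on S (bump' r)"
  unfolding bump'_def[abs_def] by (intro continuous_intros)

lemma continuous_on_bump: "continuous_on S (bump r)"
  unfolding bump_def[abs_def] by (intro continuous_intros)

lemma borel_measurable_bump [measurable]:
  "bump r \<in> borel_measurable borel" "bump' r \<in> borel_measurable borel"
  by (intro borel_measurable_continuous_onI continuous_on_bump continuous_on_bump')+

lemma bump_plateau: "bump r x = 1" if "\<bar>x\<bar> \<le> r"
proof -
  have "x\<^sup>2 \<le> r\<^sup>2" using that by (metis abs_ge_zero power2_abs power_mono)
  then show ?thesis by (simp add: bump_def max_def)
qed

lemma bump'_plateau: "bump' r x = 0" if "\<bar>x\<bar> \<le> r"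
proof -
  have "x\<^sup>2 \<le> r\<^sup>2" using that by (metis abs_ge_zero power2_abs power_mono)
  then show ?thesis by (simp add: bump'_def max_def)
qed

lemma
  assumes "r \<ge> 0" "\<bar>x\<bar> \<ge> r + 1"
  shows bump_outside: "bump r x = 0" and bump'_outside: "bump' r x = 0"
proof -
  have "(r + 1)\<^sup>2 \<le> x\<^sup>2"
    using assms by (metis add_nonneg_nonneg power2_abs power_mono zero_le_one)
  then have ge: "x\<^sup>2 - r\<^sup>2 \<ge> 1"
    using assms by (simp add: power2_sum)
  then have "1 \<le> (max 0 (x\<^sup>2 - r\<^sup>2))\<^sup>2"
    by (simp add: one_le_power max_def)
  then show "bump r x = 0" "bump' r x = 0"
    by (simp_all add: bump_def bump'_def)
qed

lemma test_function_bump: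
  assumes "r \<ge> 0"
  shows "test_function (\<lambda>(x, t). bump r x * bump 0 t) (\<lambda>(x, t). bump' r x * bump 0 t)
    (\<lambda>(x, t). bump r x * bump' 0 t)"
  unfolding test_function_def
proof (intro conjI allI)
  fix p :: "real \<times> real"
  obtain x t where p: "p = (x, t)" by force
  have dx: "((\<lambda>q. bump r (fst q)) has_derivative (\<lambda>h. bump' r x * fst h)) (at (x, t))"
    using has_derivative_compose[where f = fst and g = "bump r" and x = "(x, t)" and s = UNIV, OF has_derivative_fst[OF has_derivative_ident]]
      DERIV_bump[of r x] by (simp add: has_field_derivative_def)
  have dt: "((\<lambda>q. bump 0 (snd q)) has_derivative (\<lambda>h. bump' 0 t * snd h)) (at (x, t))"
    using has_derivative_compose[where f = snd and g = "bump 0" and x = "(x, t)" and s = UNIV, OF has_derivative_snd[OF has_derivative_ident]]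
      DERIV_bump[of 0 t] by (simp add: has_field_derivative_def)
  have "((\<lambda>q. bump r (fst q) * bump 0 (snd q)) has_derivative
      (\<lambda>h. bump r x * (bump' 0 t * snd h) + bump' r x * fst h * bump 0 t)) (at (x, t))"
    using has_derivative_mult[OF dx dt] by simp
  then show "((\<lambda>(x, t). bump r x * bump 0 t) has_derivative
      (\<lambda>h. (case p of (x, t) \<Rightarrow> bump' r x * bump 0 t) * fst h
        + (case p of (x, t) \<Rightarrow> bump r x * bump' 0 t) * snd h)) (at p)"
    unfolding p case_prod_unfold by (simp add: algebra_simps)
next
  show "continuous_on UNIV (\<lambda>(x, t). bump' r x * bump 0 t)"
    "continuous_on UNIV (\<lambda>(x, t). bump r x * bump' 0 t)"
    unfolding case_prod_unfold
    by (intro continuous_on_mult continuous_on_compose2[OF continuous_on_bump[of UNIV]]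
        continuous_on_compose2[OF continuous_on_bump'[of UNIV]] continuous_on_fst
        continuous_on_snd continuous_on_id subset_UNIV)+
next
  have "compact ({-(r+1)..r+1} \<times> {-1..1::real})"
    by (intro compact_Times compact_Icc)
  moreover have "\<forall>p. p \<notin> {-(r+1)..r+1} \<times> {-1..1} \<longrightarrow> (case p of (x, t) \<Rightarrow> bump r x * bump 0 t) = 0"
  proof (intro allI impI)
    fix p :: "real \<times> real"
    assume p: "p \<notin> {-(r+1)..r+1} \<times> {-1..1}"
    have "\<bar>fst p\<bar> \<ge> r + 1 \<or> \<bar>snd p\<bar> \<ge> 0 + 1"
      using p unfolding mem_Times_iff atLeastAtMost_iff by linarith
    then have "bump r (fst p) = 0 \<or> bump 0 (snd p) = 0"
      using bump_outside[OF assms] bump_outside[OF order_refl] by metis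
    then show "(case p of (x, t) \<Rightarrow> bump r x * bump 0 t) = 0"
      unfolding case_prod_unfold by simp
  qed
  ultimately show "\<exists>K. compact K \<and> (\<forall>p. p \<notin> K \<longrightarrow> (case p of (x, t) \<Rightarrow> bump r x * bump 0 t) = 0)"
    by (intro exI conjI)
qed

section \<open>Integrals of self-similar functions over the half plane\<close>

text \<open>
  Null sets of similarity variables give null sets in the half plane: on each line \<open>t = const > 0\<close>
  the map \<open>x \<mapsto> x / t\<close> is a dilation, which preserves null sets, and Fubini assembles the lines.
\<close>

lemma AE_lborel_quotient:
  assumes "AE \<xi> in lborel. Q \<xi>"
  shows "AE p in (lborel :: (real \<times> real) measure). snd p > 0 \<longrightarrow> Q (fst p / snd p)"
proof -
  obtain N where N: "{\<xi>. \<not> Q \<xi>} \<subseteq> N" "emeasure lborel N = 0" and "N \<in> sets lborel"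
    using assms by (auto elim!: AE_E)
  then have [measurable]: "N \<in> sets borel"
    by simp
  have "AE \<xi> in lborel. \<xi> \<notin> N"
    using N by (intro AE_not_in) (auto simp: null_sets_def)
  have *: "AE x in lborel. t > 0 \<longrightarrow> x / t \<notin> N" for t :: real
  proof (cases "t > 0")
    case True
    have "AE x in lborel. 0 + (1/t) * x \<notin> N"
      by (rule AE_borel_affine) (use True \<open>AE \<xi> in lborel. \<xi> \<notin> N\<close> in auto)
    then show ?thesis by simp
  qed simp
  have "AE t in lborel. AE x in lborel. t > 0 \<longrightarrow> x / t \<notin> N"
    using * by simp
  then have "AE x in lborel. AE t in lborel. t > 0 \<longrightarrow> x / t \<notin> N"
    by (subst lborel_pair.AE_commute) measurable
  moreover have "{p \<in> space (lborel \<Otimes>\<^sub>M lborel). snd p > 0 \<longrightarrow> fst p / snd p \<notin> N}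
      \<in> sets (lborel \<Otimes>\<^sub>M lborel)"
    by measurable
  ultimately have "AE p in lborel \<Otimes>\<^sub>M lborel. snd p > 0 \<longrightarrow> fst p / snd p \<notin> N"
    by (intro lborel_pair.AE_pair_measure) simp_all
  then have "AE p in lborel. snd p > 0 \<longrightarrow> fst p / snd p \<notin> N"
    unfolding lborel_prod .
  then show ?thesis
    by eventually_elim (use N in auto)
qed

text \<open>
  Fubini for functions all of whose horizontal slices have integrals proportional to one vector. It
  covers both kinds of integrands that occur below: products of a function of \<open>t\<close> and a function
  of \<open>x\<close>, and self-similar functions times a weight in \<open>t\<close>.
\<close>

lemma has_bochner_integral_slices:
  fixes F :: "real \<times> real \<Rightarrow> 'b::{banach, second_countable_topology}"
  assumes F: "F \<in> borel_measurable borel"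
    and k: "has_bochner_integral lborel k \<kappa>"
    and slice: "\<And>t. has_bochner_integral lborel (\<lambda>x. F (x, t)) (k t *\<^sub>R D)"
    and norm_slice: "\<And>t. has_bochner_integral lborel (\<lambda>x. norm (F (x, t))) (\<bar>k t\<bar> * D')"
  shows "has_bochner_integral lborel F (\<kappa> *\<^sub>R D)"
proof -
  have [measurable]: "F \<in> borel_measurable (lborel \<Otimes>\<^sub>M lborel)"
    using F by (simp add: lborel_prod)
  have swap: "integrable (lborel \<Otimes>\<^sub>M lborel) (\<lambda>(t, x). F (x, t))"
  proof (rule lborel_pair.Fubini_integrable)
    have "(\<lambda>t. \<integral>x. norm (F (x, t)) \<partial>lborel) = (\<lambda>t. \<bar>k t\<bar> * D')"
      using norm_slice by (auto simp: has_bochner_integral_iff)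
    then show "integrable lborel (\<lambda>t. \<integral>x. norm (case (t, x) of (t, x) \<Rightarrow> F (x, t)) \<partial>lborel)"
      using k by (auto simp: has_bochner_integral_iff)
    show "AE t in lborel. integrable lborel (\<lambda>x. case (t, x) of (t, x) \<Rightarrow> F (x, t))"
      using slice by (auto simp: has_bochner_integral_iff)
  qed measurable
  then have int: "integrable (lborel \<Otimes>\<^sub>M lborel) F"
    by (subst (asm) lborel_pair.integrable_product_swap_iff)
  have "integral\<^sup>L (lborel \<Otimes>\<^sub>M lborel) F = (\<integral>t. \<integral>x. F (x, t) \<partial>lborel \<partial>lborel)"
    using lborel_pair.integral_snd[of "\<lambda>x t. F (x, t)"] int by simp
  also have "\<dots> = (\<integral>t. k t *\<^sub>R D \<partial>lborel)"
    using slice by (simp add: has_bochner_integral_iff)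
  also have "\<dots> = \<kappa> *\<^sub>R D"
    using k by (simp add: has_bochner_integral_iff)
  finally show ?thesis
    using int by (simp add: has_bochner_integral_iff lborel_prod)
qed

lemma has_bochner_integral_prod_scaleR:
  fixes k :: "real \<Rightarrow> real" and h :: "real \<Rightarrow> 'b::{banach, second_countable_topology}"
  assumes k: "has_bochner_integral lborel k \<kappa>" and h: "has_bochner_integral lborel h D"
  shows "has_bochner_integral lborel (\<lambda>p. k (snd p) *\<^sub>R h (fst p)) (\<kappa> *\<^sub>R D)"
proof (rule has_bochner_integral_slices[OF _ k])
  have [measurable]: "k \<in> borel_measurable borel" "h \<in> borel_measurable borel"
    using k h by (auto dest!: borel_measurable_has_bochner_integral)
  show "(\<lambda>p. k (snd p) *\<^sub>R h (fst p)) \<in> borel_measurable borel"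
    unfolding borel_prod[symmetric] by measurable
  fix t
  show "has_bochner_integral lborel (\<lambda>x. k (snd (x, t)) *\<^sub>R h (fst (x, t))) (k t *\<^sub>R D)"
    using h by (auto intro: has_bochner_integral_scaleR_right)
  show "has_bochner_integral lborel (\<lambda>x. norm (k (snd (x, t)) *\<^sub>R h (fst (x, t))))
      (\<bar>k t\<bar> * (\<integral>x. norm (h x) \<partial>lborel))"
    using h by (auto simp: has_bochner_integral_iff)
qed

text \<open>
  The slice of \<open>h (x / t)\<close> at height \<open>t\<close> has \<open>t\<close> times the integral of \<open>h\<close>, so the first moment of
  the weight appears.
\<close>

lemma has_bochner_integral_self_similar:
  fixes k :: "real \<Rightarrow> real" and h :: "real \<Rightarrow> 'b::{banach, second_countable_topology}"
  assumes [measurable]: "k \<in> borel_measurable borel"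
    and tk: "has_bochner_integral lborel (\<lambda>t. indicator {0<..} t * (t * k t)) \<kappa>"
    and h: "has_bochner_integral lborel h D"
  shows "has_bochner_integral lborel
    (\<lambda>p. (indicator {0<..} (snd p) * k (snd p)) *\<^sub>R h (fst p / snd p)) (\<kappa> *\<^sub>R D)"
proof (rule has_bochner_integral_slices[OF _ tk])
  have [measurable]: "h \<in> borel_measurable borel"
    using h by (auto dest!: borel_measurable_has_bochner_integral)
  show "(\<lambda>p. (indicator {0<..} (snd p) * k (snd p)) *\<^sub>R h (fst p / snd p)) \<in> borel_measurable borel"
    unfolding borel_prod[symmetric] by measurable
  have scale: "has_bochner_integral lborel (\<lambda>x. g (x / t)) (t *\<^sub>R G)"
    if "has_bochner_integral lborel g G" "t > 0"
    for g :: "real \<Rightarrow> 'c::{banach, second_countable_topology}" and G t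
    using that lborel_has_bochner_integral_real_affine_iff[of "1/t" g G 0] by simp
  fix t :: real
  show "has_bochner_integral lborel
      (\<lambda>x. (indicator {0<..} (snd (x, t)) * k (snd (x, t))) *\<^sub>R h (fst (x, t) / snd (x, t)))
      ((indicator {0<..} t * (t * k t)) *\<^sub>R D)"
  proof (cases "t > 0")
    case True
    have "has_bochner_integral lborel (\<lambda>x. k t *\<^sub>R h (x / t)) (k t *\<^sub>R (t *\<^sub>R D))"
      by (intro has_bochner_integral_scaleR_right scale h True)
    then show ?thesis
      using True by (simp add: mult.commute)
  qed auto
  show "has_bochner_integral lborel
      (\<lambda>x. norm ((indicator {0<..} (snd (x, t)) * k (snd (x, t))) *\<^sub>R h (fst (x, t) / snd (x, t))))
      (\<bar>indicator {0<..} t * (t * k t)\<bar> * (\<integral>x. norm (h x) \<partial>lborel))"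
  proof (cases "t > 0")
    case True
    have "has_bochner_integral lborel (\<lambda>x. norm (h x)) (\<integral>x. norm (h x) \<partial>lborel)"
      using h by (auto simp: has_bochner_integral_iff)
    from scale[OF this True]
    have "has_bochner_integral lborel (\<lambda>x. \<bar>k t\<bar> * norm (h (x / t)))
        (\<bar>k t\<bar> * (t *\<^sub>R (\<integral>x. norm (h x) \<partial>lborel)))"
      by (intro has_bochner_integral_mult_right)
    then show ?thesis
      using True by (simp add: abs_mult algebra_simps)
  qed auto
qed

text \<open>
  The two half lines are treated apart because the Riemann data jump at 0.
\<close>

lemma
  fixes F f :: "real \<Rightarrow> real"
  assumes deriv: "\<And>x. (F has_real_derivative f x) (at x)" and cont: "continuous_on UNIV f"
    and "M \<ge> 0"
  shows has_bochner_integral_FTC_pos: "(\<And>x. x > M \<Longrightarrow> f x = 0) \<Longrightarrow>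
      has_bochner_integral lborel (\<lambda>x. indicator {0<..} x * f x) (F M - F 0)"
    and has_bochner_integral_FTC_neg: "(\<And>x. x < - M \<Longrightarrow> f x = 0) \<Longrightarrow>
      has_bochner_integral lborel (\<lambda>x. indicator {..<0} x * f x) (F 0 - F (- M))"
proof -
  have [measurable]: "f \<in> borel_measurable borel"
    using cont by (rule borel_measurable_continuous_onI)
  have isCont: "isCont f x" for x
    using cont by (simp add: continuous_on_eq_continuous_at)
  have Icc: "has_bochner_integral lborel (\<lambda>x. f x * indicator {a..b} x) (F b - F a)" if "a \<le> b" for a b
    by (rule has_bochner_integral_FTC_Icc_real) (use that deriv isCont in auto)
  have nz: "AE x in lborel. x \<noteq> (0::real)"
    by (rule AE_lborel_singleton)
  show "has_bochner_integral lborel (\<lambda>x. indicator {0<..} x * f x) (F M - F 0)"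
    if "\<And>x. x > M \<Longrightarrow> f x = 0"
    using Icc[OF \<open>M \<ge> 0\<close>]
  proof (rule has_bochner_integralI_AE)
    show "AE x in lborel. f x * indicator {0..M} x = indicator {0<..} x * f x"
      using nz by eventually_elim (use that in \<open>auto simp: indicator_def\<close>)
  qed auto
  have "- M \<le> 0" using \<open>M \<ge> 0\<close> by simp
  show "has_bochner_integral lborel (\<lambda>x. indicator {..<0} x * f x) (F 0 - F (- M))"
    if "\<And>x. x < - M \<Longrightarrow> f x = 0"
    using Icc[OF \<open>- M \<le> 0\<close>]
  proof (rule has_bochner_integralI_AE)
    show "AE x in lborel. f x * indicator {- M..0} x = indicator {..<0} x * f x"
      using nz by eventually_elim (use that in \<open>auto simp: indicator_def\<close>)
  qed auto
qed

lemma has_bochner_integral_riemann_data: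
  fixes \<alpha> :: "real \<Rightarrow> real" and vL vR :: "real ^ 'm"
  assumes "has_bochner_integral lborel (\<lambda>x. indicator {..<0} x * \<alpha> x) IL"
    and "has_bochner_integral lborel (\<lambda>x. indicator {0<..} x * \<alpha> x) IR"
    and [measurable]: "\<alpha> \<in> borel_measurable borel"
  shows "has_bochner_integral lborel (\<lambda>x. \<alpha> x *\<^sub>R G (riemann_data vL vR x))
    (IL *\<^sub>R G vL + IR *\<^sub>R (G vR :: 'b::{banach, second_countable_topology}))"
proof -
  have nz: "AE x in lborel. x \<noteq> (0::real)"
    by (rule AE_lborel_singleton)
  have eq: "\<alpha> x *\<^sub>R G (riemann_data vL vR x) =
      (indicator {..<0} x * \<alpha> x) *\<^sub>R G vL + (indicator {0..} x * \<alpha> x) *\<^sub>R G vR" for x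
    by (simp add: riemann_data_def indicator_def)
  have "has_bochner_integral lborel
      (\<lambda>x. (indicator {..<0} x * \<alpha> x) *\<^sub>R G vL + (indicator {0<..} x * \<alpha> x) *\<^sub>R G vR)
      (IL *\<^sub>R G vL + IR *\<^sub>R G vR)"
    using assms by (auto intro!: has_bochner_integral_add has_bochner_integral_scaleR_left)
  then show ?thesis
  proof (rule has_bochner_integralI_AE)
    show "AE x in lborel. (indicator {..<0} x * \<alpha> x) *\<^sub>R G vL + (indicator {0<..} x * \<alpha> x) *\<^sub>R G vR
        = \<alpha> x *\<^sub>R G (riemann_data vL vR x)"
      using nz by eventually_elim (auto simp: riemann_data_def indicator_def)
  qed (unfold eq, measurable)
qed

lemma riemann_data_quotient: "riemann_data vL vR (x / t) = riemann_data vL vR x" if "t > 0"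
  using that by (simp add: riemann_data_def divide_less_0_iff)

section \<open>The average over the Riemann fan\<close>

text \<open>
  Integration by parts, that is the fundamental theorem for \<open>t * bump 0 t\<close>, relates the two moments;
  positivity of \<open>\<beta>\<close> is read off from the antiderivative \<open>t - 2/5 t\<^sup>5 + t\<^sup>9/9\<close> of \<open>(1 - t\<^sup>4)\<^sup>2\<close>, and it
  is what allows the common factor \<open>\<beta>\<close> to be cancelled in the weak formulation.
\<close>

lemma has_bochner_integral_bump_moments:
  obtains \<beta> where "\<beta> > 0"
    "has_bochner_integral lborel (\<lambda>t. indicator {0<..} t * bump 0 t) \<beta>"
    "has_bochner_integral lborel (\<lambda>t. indicator {0<..} t * (t * bump' 0 t)) (- \<beta>)"
proof -
  define B where "B t = t - 2 / 5 * t^5 + t^9 / 9" for t :: real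
  have bump0: "bump 0 t = 1 - 2 * t^4 + t^8" if "\<bar>t\<bar> \<le> 1" for t
  proof -
    have "(t\<^sup>2)\<^sup>2 \<le> 1"
      using power_le_one[of "t\<^sup>2" 2] that by (simp add: abs_square_le_1)
    then have "bump 0 t = (1 - (t\<^sup>2)\<^sup>2)\<^sup>2"
      by (simp add: bump_def max_def)
    also have "\<dots> = 1 - 2 * t^4 + t^8"
      by (simp add: power2_eq_square algebra_simps eval_nat_numeral)
    finally show ?thesis .
  qed
  have nz: "AE x in lborel. x \<noteq> (0::real)"
    by (rule AE_lborel_singleton)
  have "has_bochner_integral lborel (\<lambda>t. (1 - 2 * t^4 + t^8) * indicator {0..1} t) (B 1 - B 0)"
    by (rule has_bochner_integral_FTC_Icc_real)
       (auto simp: B_def[abs_def] intro!: derivative_eq_intros continuous_intros)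
  then have bump_int: "has_bochner_integral lborel (\<lambda>t. indicator {0<..} t * bump 0 t) (B 1 - B 0)"
  proof (rule has_bochner_integralI_AE)
    show "AE t in lborel. (1 - 2 * t^4 + t^8) * indicator {0..1} t = indicator {0<..} t * bump 0 t"
      using nz
    proof eventually_elim
      case (elim t)
      then show ?case
        using bump0[of t] bump_outside[of 0 t] by (auto simp: indicator_def not_le)
    qed
  qed measurable
  have "has_bochner_integral lborel (\<lambda>t. indicator {0<..} t * (bump 0 t + t * bump' 0 t))
      (1 * bump 0 1 - 0 * bump 0 0)"
  proof (rule has_bochner_integral_FTC_pos)
    show "((\<lambda>t. t * bump 0 t) has_real_derivative bump 0 t + t * bump' 0 t) (at t)" for t
      by (auto intro!: derivative_eq_intros DERIV_bump)
    show "continuous_on UNIV (\<lambda>t. bump 0 t + t * bump' 0 t)"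
      by (intro continuous_on_add continuous_on_mult continuous_on_id continuous_on_bump continuous_on_bump')
    show "bump 0 t + t * bump' 0 t = 0" if "t > 1" for t
      using that bump_outside[of 0 t] bump'_outside[of 0 t] by simp
  qed simp
  then have "has_bochner_integral lborel (\<lambda>t. indicator {0<..} t * (bump 0 t + t * bump' 0 t)) 0"
    by (simp add: bump_outside)
  from has_bochner_integral_diff[OF this bump_int]
  have "has_bochner_integral lborel (\<lambda>t. indicator {0<..} t * (t * bump' 0 t)) (- (B 1 - B 0))"
    by (simp add: algebra_simps)
  moreover have "B 1 - B 0 > 0"
    by (simp add: B_def)
  ultimately show ?thesis
    using bump_int that by blast
qed

text \<open>
  Local integrability in space and time makes almost every time slice integrable; one slice with
  \<open>0 < t \<le> 1\<close> suffices, because after rescaling it covers the whole interval \<open>[-\<Lambda>, \<Lambda>]\<close>.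
\<close>

lemma riemann_fan_integrable:
  fixes w :: "real \<Rightarrow> 'b::{banach, second_countable_topology}"
  assumes "locally_integrable (\<lambda>(x, t). w (x / t))" and "\<Lambda> > 0"
  shows "set_integrable lborel {- \<Lambda>..\<Lambda>} w"
proof -
  define F where "F p = indicator (({- \<Lambda>..\<Lambda>} \<times> {0..1}) \<inter> half_plane) p *\<^sub>R w (fst p / snd p)" for p
  have "compact ({- \<Lambda>..\<Lambda>} \<times> {0..1::real})"
    by (intro compact_Times compact_Icc)
  then have "integrable lborel F"
    using assms(1) unfolding locally_integrable_def set_integrable_def F_def[abs_def] case_prod_unfold by blast
  then have "integrable (lborel \<Otimes>\<^sub>M lborel) (\<lambda>(x, t). F (x, t))"
    by (simp add: lborel_prod)
  from lborel_pair.AE_integrable_snd[OF this]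
  have ae: "AE t in lborel. integrable lborel (\<lambda>x. F (x, t))" .
  \<comment> \<open>A null set cannot contain the interval from 0 to 1, so a good time exists there.\<close>
  obtain t where t: "0 < t" "t \<le> 1" "integrable lborel (\<lambda>x. F (x, t))"
  proof (rule ccontr)
    assume *: "\<not> thesis"
    have "AE t in lborel. t \<notin> {0<..(1::real)}"
      using ae by eventually_elim (use that * in auto)
    then have "{0<..(1::real)} \<in> null_sets lborel"
      by (subst AE_iff_null_sets) auto
    then show False by (simp add: null_sets_def)
  qed
  from lborel_integrable_real_affine[OF t(3), of t 0] t(1)
  have "integrable lborel (\<lambda>\<xi>. F (t * \<xi>, t))"
    by simp
  then have "integrable lborel (\<lambda>\<xi>. indicator {- \<Lambda>..\<Lambda>} \<xi> *\<^sub>R F (t * \<xi>, t))"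
    by (intro integrable_mult_indicator) auto
  moreover have "indicator {- \<Lambda>..\<Lambda>} \<xi> *\<^sub>R F (t * \<xi>, t) = indicator {- \<Lambda>..\<Lambda>} \<xi> *\<^sub>R w \<xi>" for \<xi>
  proof (cases "\<xi> \<in> {- \<Lambda>..\<Lambda>}")
    case True
    then have "\<bar>t * \<xi>\<bar> \<le> 1 * \<Lambda>"
      unfolding abs_mult using t by (intro mult_mono) auto
    then show ?thesis
      using t by (simp add: F_def indicator_def abs_le_iff)
  qed simp
  ultimately show ?thesis
    by (simp add: set_integrable_def)
qed

text \<open>
  This is conservation over the fan. The weak formulation is tested with
  \<open>\<phi>(x, t) = bump \<Lambda> x * bump 0 t\<close>. As long as \<open>bump 0 t \<noteq> 0\<close>, time is below 1 and the fan
  \<open>\<bar>x\<bar> \<le> \<Lambda> t\<close> lies in the plateau of \<open>bump \<Lambda>\<close>; hence the flux term sees the two constant states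
  only, and \<open>g\<close> of the unknown profile never enters. Writing the solution as the initial
  jump plus the self-similar deviation \<open>h\<close>, the contribution of the jump to the time derivative
  cancels the initial term, and what remains is \<open>\<beta> (g vL - g vR - \<integral>h) = 0\<close>.
\<close>

lemma riemann_fan_integral:
  fixes w :: "real \<Rightarrow> real ^ 'm" and g :: "real ^ 'm \<Rightarrow> real ^ 'm"
  assumes sol: "weak_solution g (riemann_data vL vR) (\<lambda>(x, t). w (x / t))"
    and \<Lambda>: "\<Lambda> > 0"
    and left: "AE \<xi> in lborel. \<xi> \<le> - \<Lambda> \<longrightarrow> w \<xi> = vL"
    and right: "AE \<xi> in lborel. \<xi> \<ge> \<Lambda> \<longrightarrow> w \<xi> = vR"
  shows "(LINT \<xi>:{- \<Lambda>..\<Lambda>}|lborel. w \<xi>) = \<Lambda> *\<^sub>R (vL + vR) - (g vR - g vL)"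
proof -
  let ?u0 = "riemann_data vL vR"
  define h where "h \<xi> = indicator {- \<Lambda>..\<Lambda>} \<xi> *\<^sub>R (w \<xi> - ?u0 \<xi>)" for \<xi>
  define D where "D = integral\<^sup>L lborel h"
  have li: "locally_integrable (\<lambda>(x, t). w (x / t))" "locally_integrable (\<lambda>p. g (case p of (x, t) \<Rightarrow> w (x / t)))"
    using sol unfolding weak_solution_def by auto

  have "has_bochner_integral lborel (\<lambda>x. indicator {- \<Lambda>..\<Lambda>} x *\<^sub>R (?u0 x)) (\<Lambda> *\<^sub>R vL + \<Lambda> *\<^sub>R vR)"
  proof (rule has_bochner_integral_riemann_data[where G = "\<lambda>v. v"])
    have "has_bochner_integral lborel (indicator {- \<Lambda>..<0} :: real \<Rightarrow> real) (measure lborel {- \<Lambda>..<0})"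
      by (rule has_bochner_integral_real_indicator) (use \<Lambda> in auto)
    moreover have "(\<lambda>x. indicator {..<0} x * indicator {- \<Lambda>..\<Lambda>} x) = (indicator {- \<Lambda>..<0} :: real \<Rightarrow> real)"
      using \<Lambda> by (auto simp: indicator_def fun_eq_iff)
    ultimately show "has_bochner_integral lborel (\<lambda>x. indicator {..<0} x * indicator {- \<Lambda>..\<Lambda>} x) \<Lambda>"
      using \<Lambda> by simp
    have "has_bochner_integral lborel (indicator {0<..\<Lambda>} :: real \<Rightarrow> real) (measure lborel {0<..\<Lambda>})"
      by (rule has_bochner_integral_real_indicator) (use \<Lambda> in auto)
    moreover have "(\<lambda>x. indicator {0<..} x * indicator {- \<Lambda>..\<Lambda>} x) = (indicator {0<..\<Lambda>} :: real \<Rightarrow> real)"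
      using \<Lambda> by (auto simp: indicator_def fun_eq_iff)
    ultimately show "has_bochner_integral lborel (\<lambda>x. indicator {0<..} x * indicator {- \<Lambda>..\<Lambda>} x) \<Lambda>"
      using \<Lambda> by simp
  qed measurable
  then have u0_int: "has_bochner_integral lborel (\<lambda>x. indicator {- \<Lambda>..\<Lambda>} x *\<^sub>R ?u0 x) (\<Lambda> *\<^sub>R (vL + vR))"
    by (simp add: scaleR_add_right)
  have w_int: "integrable lborel (\<lambda>\<xi>. indicator {- \<Lambda>..\<Lambda>} \<xi> *\<^sub>R w \<xi>)"
    using riemann_fan_integrable[OF li(1) \<Lambda>] by (simp add: set_integrable_def)
  have h_eq: "h = (\<lambda>\<xi>. indicator {- \<Lambda>..\<Lambda>} \<xi> *\<^sub>R w \<xi> - indicator {- \<Lambda>..\<Lambda>} \<xi> *\<^sub>R ?u0 \<xi>)"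
    by (auto simp: h_def scaleR_diff_right)
  have h_int: "integrable lborel h"
    unfolding h_eq using w_int u0_int by (auto simp: has_bochner_integral_iff)
  have D: "D = (LINT \<xi>:{- \<Lambda>..\<Lambda>}|lborel. w \<xi>) - \<Lambda> *\<^sub>R (vL + vR)"
    unfolding D_def h_eq set_lebesgue_integral_def using w_int u0_int
    by (simp add: has_bochner_integral_iff)

  obtain \<beta> where \<beta>: "\<beta> > 0"
    "has_bochner_integral lborel (\<lambda>t. indicator {0<..} t * bump 0 t) \<beta>"
    "has_bochner_integral lborel (\<lambda>t. indicator {0<..} t * (t * bump' 0 t)) (- \<beta>)"
    by (rule has_bochner_integral_bump_moments)
  have bump'_int: "has_bochner_integral lborel (\<lambda>t. indicator {0<..} t * bump' 0 t) (- 1)"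
    using has_bochner_integral_FTC_pos[OF DERIV_bump continuous_on_bump', of 1 0]
    by (simp add: bump'_outside bump_outside bump_plateau)
  have "has_bochner_integral lborel (\<lambda>x. bump' \<Lambda> x *\<^sub>R g (?u0 x)) (1 *\<^sub>R g vL + (- 1) *\<^sub>R g vR)"
    using has_bochner_integral_FTC_pos[OF DERIV_bump continuous_on_bump', of "\<Lambda> + 1" \<Lambda>]
      has_bochner_integral_FTC_neg[OF DERIV_bump continuous_on_bump', of "\<Lambda> + 1" \<Lambda>] \<Lambda>
    by (intro has_bochner_integral_riemann_data) (auto simp: bump'_outside bump_outside bump_plateau)
  then have flux_int: "has_bochner_integral lborel (\<lambda>x. bump' \<Lambda> x *\<^sub>R g (?u0 x)) (g vL - g vR)"
    by simp
  have bump_int: "integrable lborel (bump \<Lambda>)"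
  proof -
    have "integrable lborel (\<lambda>x. indicator {- (\<Lambda> + 1)..\<Lambda> + 1} x *\<^sub>R bump \<Lambda> x)"
      using continuous_on_bump by (intro borel_integrable_compact) auto
    moreover have "indicator {- (\<Lambda> + 1)..\<Lambda> + 1} x *\<^sub>R bump \<Lambda> x = bump \<Lambda> x" for x
    proof (cases "\<bar>x\<bar> \<ge> \<Lambda> + 1")
      case True
      then show ?thesis using \<Lambda> bump_outside[of \<Lambda> x] by simp
    next
      case False
      then have "x \<in> {- (\<Lambda> + 1)..\<Lambda> + 1}" unfolding atLeastAtMost_iff by linarith
      then show ?thesis by simp
    qed
    ultimately show ?thesis by (simp only:)
  qed
  obtain C where C: "has_bochner_integral lborel (\<lambda>x. bump \<Lambda> x *\<^sub>R ?u0 x) C"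
    using has_bochner_integral_riemann_data[where \<alpha> = "bump \<Lambda>" and G = "\<lambda>v. v"]
      integrable_real_mult_indicator[OF _ bump_int]
    by (auto simp: has_bochner_integral_iff mult.commute)

  \<comment> \<open>\<open>T\<close> is the space-time integrand of the weak form, and \<open>T'\<close> its splitting into
    deviation, jump and flux parts, which agrees with it almost everywhere.\<close>
  define T where "T p = indicator half_plane p *\<^sub>R
      ((bump \<Lambda> (fst p) * bump' 0 (snd p)) *\<^sub>R w (fst p / snd p) +
       (bump' \<Lambda> (fst p) * bump 0 (snd p)) *\<^sub>R g (w (fst p / snd p)))" for p
  define T' where "T' p =
      (indicator {0<..} (snd p) * bump' 0 (snd p)) *\<^sub>R h (fst p / snd p) +
      (indicator {0<..} (snd p) * bump' 0 (snd p)) *\<^sub>R (bump \<Lambda> (fst p) *\<^sub>R ?u0 (fst p)) +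
      (indicator {0<..} (snd p) * bump 0 (snd p)) *\<^sub>R (bump' \<Lambda> (fst p) *\<^sub>R g (?u0 (fst p)))" for p
  have T': "has_bochner_integral lborel T' ((- \<beta>) *\<^sub>R D + (- 1) *\<^sub>R C + \<beta> *\<^sub>R (g vL - g vR))"
    unfolding T'_def D_def
    using has_bochner_integral_self_similar[OF _ \<beta>(3) has_bochner_integral_integrable[OF h_int]]
      has_bochner_integral_prod_scaleR[OF bump'_int C]
      has_bochner_integral_prod_scaleR[OF \<beta>(2) flux_int]
    by (intro has_bochner_integral_add) auto
  have T_meas: "T \<in> borel_measurable borel"
  proof -
    let ?K = "{- (\<Lambda> + 1)..\<Lambda> + 1} \<times> {- 1..1::real}"
    have K: "compact ?K"
      by (intro compact_Times compact_Icc)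
    have [measurable]: "(\<lambda>p. indicator (?K \<inter> half_plane) p *\<^sub>R w (fst p / snd p)) \<in> borel_measurable borel"
      "(\<lambda>p. indicator (?K \<inter> half_plane) p *\<^sub>R g (w (fst p / snd p))) \<in> borel_measurable borel"
      using li K unfolding locally_integrable_def set_integrable_def case_prod_unfold
      by (auto dest!: borel_measurable_integrable spec[of _ ?K])
    have [measurable]: "fst \<in> borel_measurable (borel :: (real \<times> real) measure)"
      "snd \<in> borel_measurable (borel :: (real \<times> real) measure)"
      unfolding borel_prod[symmetric] by measurable
    \<comment> \<open>Measurability of \<open>w\<close> and of \<open>g\<close> composed with \<open>w\<close> is known on compact sets only, so the
      indicator of the support of the test function is inserted.\<close>
    have T_eq: "T = (\<lambda>p. (bump \<Lambda> (fst p) * bump' 0 (snd p)) *\<^sub>R (indicator (?K \<inter> half_plane) p *\<^sub>R w (fst p / snd p))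
        + (bump' \<Lambda> (fst p) * bump 0 (snd p)) *\<^sub>R (indicator (?K \<inter> half_plane) p *\<^sub>R g (w (fst p / snd p))))"
    proof
      fix p :: "real \<times> real"
      show "T p = (bump \<Lambda> (fst p) * bump' 0 (snd p)) *\<^sub>R (indicator (?K \<inter> half_plane) p *\<^sub>R w (fst p / snd p))
        + (bump' \<Lambda> (fst p) * bump 0 (snd p)) *\<^sub>R (indicator (?K \<inter> half_plane) p *\<^sub>R g (w (fst p / snd p)))"
      proof (cases "p \<in> ?K")
        case True
        then show ?thesis by (simp add: T_def indicator_def scaleR_add_right)
      next
        case False
        have "\<bar>fst p\<bar> \<ge> \<Lambda> + 1 \<or> \<bar>snd p\<bar> \<ge> 0 + 1"
          using False unfolding mem_Times_iff atLeastAtMost_iff by linarith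
        then show ?thesis
          using False \<Lambda> bump_outside[of \<Lambda> "fst p"] bump'_outside[of \<Lambda> "fst p"]
            bump_outside[of 0 "snd p"] bump'_outside[of 0 "snd p"]
          by (auto simp: T_def)
      qed
    qed
    show ?thesis unfolding T_eq by measurable
  qed
  have T_T': "AE p in lborel. T p = T' p"
    using AE_lborel_quotient[OF left] AE_lborel_quotient[OF right]
  proof eventually_elim
    case (elim p)
    obtain x t where p: "p = (x, t)" by force
    show ?case
    proof (cases "t > 0")
      case t: True
      have left: "w (x / t) = ?u0 x" if "x \<le> - (\<Lambda> * t)"
        using elim(1) t that \<Lambda> by (simp add: p field_simps riemann_data_def) (smt (verit) mult_pos_pos)
      have right: "w (x / t) = ?u0 x" if "x \<ge> \<Lambda> * t"
        using elim(2) t that \<Lambda> by (simp add: p field_simps riemann_data_def) (smt (verit) mult_pos_pos)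
      have h: "h (x / t) = w (x / t) - ?u0 x"
      proof (cases "\<bar>x\<bar> \<le> \<Lambda> * t")
        case True
        then show ?thesis
          using t by (simp add: h_def riemann_data_quotient indicator_def field_simps abs_le_iff)
      next
        case False
        then have "x \<le> - (\<Lambda> * t) \<or> x \<ge> \<Lambda> * t" by linarith
        with left right have "w (x / t) = ?u0 x" by blast
        then show ?thesis
          using t by (simp add: h_def riemann_data_quotient)
      qed
      \<comment> \<open>After the cutoff time, inside the fan, outside the fan.\<close>
      consider "t \<ge> 1" | "t < 1" "\<bar>x\<bar> \<le> \<Lambda> * t" | "t < 1" "\<bar>x\<bar> \<ge> \<Lambda> * t"
        by linarith
      then show ?thesis
      proof cases
        case 1
        then show ?thesis
          using bump_outside[of 0 t] bump'_outside[of 0 t] by (simp add: T_def T'_def p)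
      next
        case 2
        have "\<Lambda> * t \<le> \<Lambda> * 1"
          using 2 \<Lambda> by (intro mult_left_mono) auto
        with 2 have "\<bar>x\<bar> \<le> \<Lambda>" by simp
        then show ?thesis
          using t by (simp add: T_def T'_def p h bump_plateau bump'_plateau algebra_simps)
      next
        case 3
        then have "x \<le> - (\<Lambda> * t) \<or> x \<ge> \<Lambda> * t" by linarith
        with left right have "w (x / t) = ?u0 x" by blast
        then show ?thesis
          using t by (simp add: T_def T'_def p h algebra_simps)
      qed
    qed (simp add: T_def T'_def p)
  qed
  have "integral\<^sup>L lborel T = integral\<^sup>L lborel T'"
    using T_meas T' T_T' by (intro integral_cong_AE) (auto simp: has_bochner_integral_iff)
  also have "\<dots> = (- \<beta>) *\<^sub>R D + (- 1) *\<^sub>R C + \<beta> *\<^sub>R (g vL - g vR)"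
    using T' by (simp add: has_bochner_integral_iff)
  finally have int_T: "integral\<^sup>L lborel T = \<beta> *\<^sub>R (g vL - g vR - D) - C"
    by (simp add: algebra_simps)
  have "weak_form (\<lambda>(x, t). w (x / t)) (\<lambda>p. g (case p of (x, t) \<Rightarrow> w (x / t))) ?u0
      (\<lambda>(x, t). bump \<Lambda> x * bump 0 t) (\<lambda>(x, t). bump' \<Lambda> x * bump 0 t) (\<lambda>(x, t). bump \<Lambda> x * bump' 0 t) = 0"
    using sol test_function_bump[of \<Lambda>] \<Lambda> unfolding weak_solution_def by auto
  then have "integral\<^sup>L lborel T + (\<integral>x. bump \<Lambda> x *\<^sub>R ?u0 x \<partial>lborel) = 0"
    unfolding weak_form_def set_lebesgue_integral_def T_def case_prod_unfold
    by (simp add: bump_plateau)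
  with int_T C have "\<beta> *\<^sub>R (g vL - g vR - D) = 0"
    by (simp add: has_bochner_integral_iff)
  with \<beta>(1) have "D = g vL - g vR"
    by simp
  with D show ?thesis
    by (simp add: algebra_simps)
qed

text \<open>
  For \<open>\<Lambda> = 1 / (2 t)\<close> the substitution \<open>x = t \<xi>\<close> maps the fan \<open>[-\<Lambda>, \<Lambda>]\<close> onto the unit interval of
  the average, and the condition on \<open>t\<close> says that \<open>\<Lambda>\<close> bounds the wave speeds.
\<close>

lemma riemann_average_eq:
  fixes A :: "(real ^ 'm) set" and n :: "real ^ 'd"
  assumes sys: "hyperbolic_system A f E v lmax" and "vL \<in> A" "vR \<in> A" "norm n = 1"
    and t: "t > 0" "t * lmax n vL vR \<le> 1/2"
  shows "riemann_average v t n vL vR = (1/2) *\<^sub>R (vL + vR) - t *\<^sub>R (f vR *v n - f vL *v n)"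
proof -
  define \<Lambda> where "\<Lambda> = 1 / (2 * t)"
  have \<Lambda>: "\<Lambda> > 0" "lmax n vL vR \<le> \<Lambda>"
    using t by (auto simp: \<Lambda>_def field_simps)
  have sol: "riemann_solution A f E n vL vR (v n vL vR)"
    and l: "AE \<xi> in lborel. \<xi> \<le> - lmax n vL vR \<longrightarrow> v n vL vR \<xi> = vL"
    and r: "AE \<xi> in lborel. \<xi> \<ge> lmax n vL vR \<longrightarrow> v n vL vR \<xi> = vR"
    using assms unfolding hyperbolic_system_def by auto
  have "(LINT \<xi>:{- \<Lambda>..\<Lambda>}|lborel. v n vL vR \<xi>) = \<Lambda> *\<^sub>R (vL + vR) - (f vR *v n - f vL *v n)"
  proof (rule riemann_fan_integral[where g = "\<lambda>u. f u *v n"])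
    show "weak_solution (\<lambda>u. f u *v n) (riemann_data vL vR) (\<lambda>(x, t). v n vL vR (x / t))"
      using sol by (simp add: riemann_solution_def)
    show "AE \<xi> in lborel. \<xi> \<le> - \<Lambda> \<longrightarrow> v n vL vR \<xi> = vL"
      using l by eventually_elim (use \<Lambda> in auto)
    show "AE \<xi> in lborel. \<xi> \<ge> \<Lambda> \<longrightarrow> v n vL vR \<xi> = vR"
      using r by eventually_elim (use \<Lambda> in auto)
  qed (use \<Lambda> in auto)
  moreover have "riemann_average v t n vL vR = t *\<^sub>R (LINT \<xi>:{- \<Lambda>..\<Lambda>}|lborel. v n vL vR \<xi>)"
  proof -
    have ind: "indicator {- (1/2)..1/2} (t * \<xi>) = (indicator {- \<Lambda>..\<Lambda>} \<xi> :: real)" for \<xi>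
      using t by (auto simp: indicator_def \<Lambda>_def field_simps)
    show ?thesis
      unfolding riemann_average_def set_lebesgue_integral_def
      using t by (subst lborel_integral_real_affine[where c = t and t = 0]) (simp_all add: ind)
  qed
  ultimately show ?thesis
    using t by (simp add: \<Lambda>_def scaleR_diff_right)
qed

section \<open>Convex structure of the low-order update\<close>

text \<open>
  The bar state is the Riemann average at the fictitious time \<open>norm (c i j) / (2 * d i j)\<close>, which the
  viscosity \<open>d i j\<close> keeps small enough for the waves not to leave the unit interval.
\<close>

lemma bar_state_mem_invariant_set:
  assumes sys: "hyperbolic_system A f E v lmax"
    and inv: "invariant_set A v lmax S \<tau>0 B"
    and U: "U i \<in> B" "U j \<in> B" and "j \<noteq> i"
    and c: "c i j \<noteq> 0" and d: "d i j > 0"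
    and speed: "lmax (c i j /\<^sub>R norm (c i j)) (U i) (U j) * norm (c i j) \<le> d i j"
  shows "bar_state f d c U i j \<in> B"
proof -
  define n where "n = c i j /\<^sub>R norm (c i j)"
  define t where "t = norm (c i j) / (2 * d i j)"
  have n: "norm n = 1" and t: "t > 0"
    using c d by (simp_all only: n_def t_def norm_scaleR) simp_all
  have cfl: "t * lmax n (U i) (U j) \<le> 1/2"
  proof -
    have "t * lmax n (U i) (U j) = lmax n (U i) (U j) * norm (c i j) / (2 * d i j)"
      by (simp add: t_def)
    also have "\<dots> \<le> d i j / (2 * d i j)"
      using speed d by (intro divide_right_mono) (simp_all add: n_def)
    finally show ?thesis
      using d by simp
  qed
  have "\<forall>vL\<in>B. \<forall>vR\<in>B. \<forall>n t. norm n = 1 \<and> t > 0 \<and> t * lmax n vL vR \<le> 1/2 \<longrightarrow>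
      riemann_average v t n vL vR \<in> B"
    using inv unfolding invariant_set_def by (elim conjE)
  from this[rule_format, OF U, of n t] n t cfl have "riemann_average v t n (U i) (U j) \<in> B"
    by blast
  moreover have "B \<subseteq> A"
    using inv unfolding invariant_set_def by (elim conjE)
  then have "U i \<in> A" "U j \<in> A"
    using U by blast+
  ultimately have "(1/2) *\<^sub>R (U i + U j) - t *\<^sub>R (f (U j) *v n - f (U i) *v n) \<in> B"
    by (simp only: riemann_average_eq[OF sys _ _ n t cfl])
  moreover have "c i j /\<^sub>R (2 * d i j) = t *\<^sub>R n"
  proof -
    have "inverse (2 * d i j) = t * inverse (norm (c i j))"
      using c d by (simp add: t_def field_simps)
    then show ?thesis
      by (simp only: n_def scaleR_scaleR)
  qed
  ultimately show ?thesis
    using \<open>j \<noteq> i\<close>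
    by (simp only: bar_state_def if_False matrix_vector_mult_diff_rdistrib
        matrix_vector_mult_scaleR scaleR_diff_right)
qed

text \<open>
  Since the \<open>c i j\<close> sum to zero, \<open>f (U i)\<close> may be subtracted from every flux, and the update becomes
  a sum of multiples of \<open>bar_state f d c U i j - U i\<close> and the source. Splitting \<open>U i\<close> into two halves,
  one for the source and one for the fluxes, shows that \<open>W\<close> is the midpoint of
  \<open>U i + 2 \<Delta>t s\<close> and a convex combination of the bar states; the splitting doubles the effective
  time step, which accounts for the factor 4 in the time step condition and the factor 2 in front of
  the source.
\<close>

lemma low_order_update_mem_convex:
  fixes f :: "real ^ 'm \<Rightarrow> real ^ 'd ^ 'm"
  assumes C: "convex C" "U i + (2 * \<Delta>t) *\<^sub>R s \<in> C" "\<And>j. j \<in> N \<Longrightarrow> bar_state f d c U i j \<in> C"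
    and N: "finite N" "i \<in> N"
    and m: "m > 0" and \<Delta>t: "\<Delta>t > 0"
    and c_sum: "(\<Sum>j\<in>N. c i j) = 0"
    and d: "\<And>j. j \<in> N - {i} \<Longrightarrow> d i j > 0" "d i i = - (\<Sum>j\<in>N - {i}. d i j)"
    and cfl: "1 + 4 * \<Delta>t * (d i i / m) \<ge> 0"
    and update: "(m / \<Delta>t) *\<^sub>R (W - U i) + (\<Sum>j\<in>N. f (U j) *v c i j)
        - (\<Sum>j\<in>N - {i}. d i j *\<^sub>R (U j - U i)) = m *\<^sub>R s"
  shows "W \<in> C"
proof -
  let ?bar = "bar_state f d c U i" and ?N = "N - {i}"
  \<comment> \<open>The diagonal weight is \<open>1 + 4 \<Delta>t d\<^sub>i\<^sub>i / m\<close>, because \<open>d\<^sub>i\<^sub>i\<close> is minus the sum of the others.\<close>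
  define \<alpha> where "\<alpha> j = (if j = i then 1 else 0) + 4 * \<Delta>t * (d i j / m)" for j
  define Z where "Z = (\<Sum>j\<in>N. \<alpha> j *\<^sub>R ?bar j)"
  have \<alpha>_sum: "sum \<alpha> N = 1"
  proof -
    have "sum \<alpha> ?N = (\<Sum>j\<in>?N. 4 * \<Delta>t / m * d i j)"
      by (intro sum.cong) (auto simp: \<alpha>_def)
    also have "\<dots> = 4 * \<Delta>t / m * sum (d i) ?N"
      by (rule sum_distrib_left[symmetric])
    also have "\<dots> = - (4 * \<Delta>t * (d i i / m))"
      using d(2) by simp
    finally have "sum \<alpha> ?N = - (4 * \<Delta>t * (d i i / m))" .
    moreover have "\<alpha> i = 1 + 4 * \<Delta>t * (d i i / m)"
      by (simp add: \<alpha>_def)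
    ultimately show ?thesis
      using sum.remove[OF N, of \<alpha>] by linarith
  qed
  have "Z \<in> C"
    unfolding Z_def
  proof (rule convex_sum)
    show "\<alpha> j \<ge> 0" if "j \<in> N" for j
    proof (cases "j = i")
      case True
      with cfl show ?thesis by (simp add: \<alpha>_def)
    next
      case False
      with that d(1)[of j] \<Delta>t m show ?thesis by (simp add: \<alpha>_def)
    qed
  qed (use C N \<alpha>_sum in auto)
  have visc: "(2 * d i j) *\<^sub>R (?bar j - U i) = d i j *\<^sub>R (U j - U i) - (f (U j) - f (U i)) *v c i j"
    if "j \<in> ?N" for j
  proof -
    have half: "(1/2) *\<^sub>R (U i + U j) - U i = (1/2) *\<^sub>R (U j - U i)"
    proof -
      have "(1/2) *\<^sub>R (U i + U j) - U i = (1/2) *\<^sub>R ((U i + U j) - (U i + U i))"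
        by (simp only: scaleR_diff_right scaleR_half_double)
      also have "(U i + U j) - (U i + U i) = U j - U i"
        by (rule add_diff_cancel_left)
      finally show ?thesis .
    qed
    have c_scale: "c i j /\<^sub>R (2 * d i j) = (1 / (2 * d i j)) *\<^sub>R c i j"
      by (simp only: inverse_eq_divide)
    have bar: "?bar j = (1/2) *\<^sub>R (U i + U j) - (f (U j) - f (U i)) *v (c i j /\<^sub>R (2 * d i j))"
      using that by (simp only: bar_state_def Diff_iff singleton_iff if_False)
    have "?bar j - U i = ((1/2) *\<^sub>R (U i + U j) - U i) - (f (U j) - f (U i)) *v (c i j /\<^sub>R (2 * d i j))"
      unfolding bar by (simp only: diff_diff_eq add.commute)
    then have "?bar j - U i = (1/2) *\<^sub>R (U j - U i)
        - (1 / (2 * d i j)) *\<^sub>R ((f (U j) - f (U i)) *v c i j)"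
      unfolding half c_scale matrix_vector_mult_scaleR .
    then show ?thesis
      using d(1)[OF that] by (simp add: scaleR_diff_right)
  qed
  have flux: "(\<Sum>j\<in>N. f (U j) *v c i j) = (\<Sum>j\<in>?N. (f (U j) - f (U i)) *v c i j)"
  proof -
    have "(\<Sum>j\<in>N. f (U i) *v c i j) = f (U i) *v (\<Sum>j\<in>N. c i j)"
      by (rule linear_sum[OF matrix_vector_mul_linear, symmetric])
    then have "(\<Sum>j\<in>N. f (U j) *v c i j) = (\<Sum>j\<in>N. (f (U j) - f (U i)) *v c i j)"
      by (simp add: c_sum matrix_vector_mult_diff_rdistrib sum_subtractf)
    also have "\<dots> = (\<Sum>j\<in>?N. (f (U j) - f (U i)) *v c i j)"
      using N by (simp add: sum.remove[of N i])
    finally show ?thesis .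
  qed
  have visc_sum: "(\<Sum>j\<in>?N. (2 * d i j) *\<^sub>R (?bar j - U i)) =
      (\<Sum>j\<in>?N. d i j *\<^sub>R (U j - U i)) - (\<Sum>j\<in>?N. (f (U j) - f (U i)) *v c i j)"
    unfolding sum_subtractf[symmetric] by (intro sum.cong refl visc)
  have "(m / \<Delta>t) *\<^sub>R (W - U i) = m *\<^sub>R s + (\<Sum>j\<in>?N. (2 * d i j) *\<^sub>R (?bar j - U i))"
    using update unfolding flux visc_sum by (simp only: add_diff_eq eq_diff_eq diff_eq_eq)
  then have "(\<Delta>t / m) *\<^sub>R ((m / \<Delta>t) *\<^sub>R (W - U i)) =
      (\<Delta>t / m) *\<^sub>R (m *\<^sub>R s + (\<Sum>j\<in>?N. (2 * d i j) *\<^sub>R (?bar j - U i)))"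
    by (simp only:)
  then have W: "W = U i + \<Delta>t *\<^sub>R s + (\<Delta>t / m) *\<^sub>R (\<Sum>j\<in>?N. (2 * d i j) *\<^sub>R (?bar j - U i))"
    using m \<Delta>t by (simp add: algebra_simps)
  have "Z - U i = (\<Sum>j\<in>N. \<alpha> j *\<^sub>R (?bar j - U i))"
    using \<alpha>_sum by (simp add: Z_def scaleR_diff_right sum_subtractf flip: scaleR_sum_left)
  also have "\<dots> = (\<Sum>j\<in>?N. \<alpha> j *\<^sub>R (?bar j - U i))"
    using N by (simp add: sum.remove[of N i] bar_state_def)
  also have "\<dots> = (2 * \<Delta>t / m) *\<^sub>R (\<Sum>j\<in>?N. (2 * d i j) *\<^sub>R (?bar j - U i))"
    unfolding scaleR_sum_right by (intro sum.cong) (auto simp: \<alpha>_def)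
  finally have Z: "Z = U i + (2 * \<Delta>t / m) *\<^sub>R (\<Sum>j\<in>?N. (2 * d i j) *\<^sub>R (?bar j - U i))"
    by (simp add: algebra_simps)
  have "(1/2) *\<^sub>R (U i + (2 * \<Delta>t) *\<^sub>R s) + (1/2) *\<^sub>R Z \<in> C"
    using C \<open>Z \<in> C\<close> by (intro convexD) auto
  also have "(1/2) *\<^sub>R (U i + (2 * \<Delta>t) *\<^sub>R s) + (1/2) *\<^sub>R Z = W"
  proof -
    have "(1/2) *\<^sub>R (U i + a) + (1/2) *\<^sub>R (U i + b) = (1/2) *\<^sub>R (U i + U i) + (1/2) *\<^sub>R a + (1/2) *\<^sub>R b"
      for a b
      by (simp only: scaleR_add_right ac_simps)
    then show ?thesis
      unfolding W Z scaleR_half_double by simp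
  qed
  finally show ?thesis .
qed

section \<open>Limiting and the invariant domain property\<close>

text \<open>
  Attainment of the maximum makes the greatest element an actual member of the constraint set, so
  that its defining inequality may be used.
\<close>

lemma limiter_bound_attained:
  assumes zero: "admissible_limiter C \<Psi> \<psi>min W P 0"
    and attained: "limiter_max_attained C \<Psi> \<psi>min W P"
  shows "0 \<le> limiter_bound C \<Psi> \<psi>min W P"
    and "admissible_limiter C \<Psi> \<psi>min W P (limiter_bound C \<Psi> \<psi>min W P)"
proof -
  let ?adm = "admissible_limiter C \<Psi> \<psi>min W P"
  have "0 \<le> limiter_bound C \<Psi> \<psi>min W P \<and> ?adm (limiter_bound C \<Psi> \<psi>min W P)"
  proof (cases "?adm 1")
    case False
    then obtain \<theta> where \<theta>: "\<theta> \<in> {0..1}" "?adm \<theta>" "\<forall>\<theta>'\<in>{0..1}. ?adm \<theta>' \<longrightarrow> \<theta>' \<le> \<theta>"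
      using attained unfolding limiter_max_attained_def by auto
    have "(GREATEST \<theta>. \<theta> \<in> {0..1} \<and> ?adm \<theta>) = \<theta>"
      by (rule Greatest_equality) (use \<theta> in auto)
    then show ?thesis
      using \<theta> False by (simp add: limiter_bound_def)
  qed (simp add: limiter_bound_def)
  then show "0 \<le> limiter_bound C \<Psi> \<psi>min W P" "?adm (limiter_bound C \<Psi> \<psi>min W P)"
    by auto
qed

text \<open>
  An admissible limiter can be decreased: the constraint set is convex by quasiconcavity and contains
  both ends of the segment from \<open>W\<close> to \<open>W + b P\<close>. This is what permits the symmetrisation of
  the limiters by a minimum.
\<close>

lemma admissible_limiter_downward:
  assumes "quasiconcave_on C \<Psi>"
    and zero: "admissible_limiter C \<Psi> \<psi>min W P 0"
    and b: "admissible_limiter C \<Psi> \<psi>min W P b" and \<theta>: "0 \<le> \<theta>" "\<theta> \<le> b"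
  shows "admissible_limiter C \<Psi> \<psi>min W P \<theta>"
proof (cases "b = 0")
  case False
  then have "b > 0" using \<theta> by simp
  let ?L = "{u \<in> C. \<Psi> u \<ge> \<psi>min}"
  have "convex ?L"
    using assms(1) by (simp add: quasiconcave_on_def)
  moreover have "W \<in> ?L" "W + b *\<^sub>R P \<in> ?L"
    using zero b by (auto simp: admissible_limiter_def)
  ultimately have "(1 - \<theta> / b) *\<^sub>R W + (\<theta> / b) *\<^sub>R (W + b *\<^sub>R P) \<in> ?L"
    using \<theta> \<open>b > 0\<close> by (intro convexD_alt) (auto simp: field_simps)
  moreover have "(1 - \<theta> / b) *\<^sub>R W + (\<theta> / b) *\<^sub>R (W + b *\<^sub>R P) = W + \<theta> *\<^sub>R P"
    using \<open>b > 0\<close> by (simp add: algebra_simps)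
  ultimately show ?thesis
    by (simp add: admissible_limiter_def)
qed (use assms in auto)

theorem theorem7p24:
  fixes A :: "(real ^ 'm) set"
    and f :: "real ^ 'm \<Rightarrow> real ^ 'd ^ 'm"
    and S :: "real ^ 'm \<Rightarrow> real ^ 'm"
    and E :: "((real ^ 'm \<Rightarrow> real) \<times> (real ^ 'm \<Rightarrow> real ^ 'd)) set"
    and v :: "real ^ 'd \<Rightarrow> real ^ 'm \<Rightarrow> real ^ 'm \<Rightarrow> real \<Rightarrow> real ^ 'm"
    and lmax :: "real ^ 'd \<Rightarrow> real ^ 'm \<Rightarrow> real ^ 'm \<Rightarrow> real"
    and V :: "'i set" and N :: "'i \<Rightarrow> 'i set"
    and m :: "'i \<Rightarrow> real" and c :: "'i \<Rightarrow> 'i \<Rightarrow> real ^ 'd"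
    and \<Delta>t :: real
    and U UL UH Unew :: "'i \<Rightarrow> real ^ 'm"
    and d :: "'i \<Rightarrow> 'i \<Rightarrow> real"
    and FH AA P :: "'i \<Rightarrow> 'i \<Rightarrow> real ^ 'm"
    and \<mu> \<theta> :: "'i \<Rightarrow> 'i \<Rightarrow> real"
    and LL :: "'l set" and BB :: "'l \<Rightarrow> (real ^ 'm) set"
    and \<Psi> :: "'l \<Rightarrow> real ^ 'm \<Rightarrow> real"
    and \<psi>min :: "'i \<Rightarrow> 'l \<Rightarrow> real"
    and \<theta>1 :: "'i \<Rightarrow> 'i \<Rightarrow> 'l \<Rightarrow> real"
    and B :: "(real ^ 'm) set" and \<tau>0 :: real
  assumes system: "hyperbolic_system A f E v lmax"
    and stencil: "finite V" "\<forall>i\<in>V. N i \<subseteq> V \<and> i \<in> N i"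
      "\<forall>i\<in>V. \<forall>j\<in>V. j \<in> N i \<longleftrightarrow> i \<in> N j"
    and mass: "\<forall>i\<in>V. m i > 0"
    and c_skew: "\<forall>i\<in>V. \<forall>j\<in>N i. c i j = - c j i"
    and c_sum: "\<forall>i\<in>V. (\<Sum>j\<in>N i. c i j) = 0"
    and step: "\<Delta>t > 0"
    and U_adm: "\<forall>i\<in>V. U i \<in> A"
    and d_def: "d = low_viscosity lmax N c U"
    and d_pos: "\<forall>i\<in>V. \<forall>j\<in>N i - {i}. d i j > 0"
    and low_update: "\<forall>i\<in>V. (m i / \<Delta>t) *\<^sub>R (UL i - U i) + (\<Sum>j\<in>N i. f (U j) *v c i j)
        - (\<Sum>j\<in>N i - {i}. d i j *\<^sub>R (U j - U i)) = m i *\<^sub>R S (U i)"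
    and FH_skew: "\<forall>i\<in>V. \<forall>j\<in>N i. FH i j = - FH j i"
    and high_update: "\<forall>i\<in>V. (m i / \<Delta>t) *\<^sub>R (UH i - U i) + (\<Sum>j\<in>N i. FH i j) = m i *\<^sub>R S (U i)"
    and AA_def: "\<forall>i\<in>V. \<forall>j\<in>N i. AA i j = \<Delta>t *\<^sub>R (low_flux f d c U i j - FH i j)"
    and weights: "\<forall>i\<in>V. (\<forall>j\<in>N i - {i}. \<mu> i j > 0) \<and> (\<Sum>j\<in>N i - {i}. \<mu> i j) = 1"
    and P_def: "\<forall>i\<in>V. \<forall>j\<in>N i - {i}. P i j = (1 / (m i * \<mu> i j)) *\<^sub>R AA i j"
    and LL: "finite LL" "LL \<noteq> {}"
    and BB: "\<forall>l\<in>LL. convex (BB l)"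
    and \<Psi>: "\<forall>l\<in>LL. quasiconcave_on (BB l) (\<Psi> l)"
    and B_def: "B = {u \<in> (\<Inter>l\<in>LL. BB l). \<forall>l\<in>LL. \<Psi> l u \<ge> 0}"
    and B_inv: "invariant_set A v lmax S \<tau>0 B"
    and cfl: "(MIN i\<in>V. 1 + 4 * \<Delta>t * (d i i / m i)) \<ge> 0" "2 * \<Delta>t \<le> \<tau>0"
    and \<psi>min_def: "\<forall>i\<in>V. \<forall>l\<in>LL. \<psi>min i l = local_min f S N d c \<Delta>t U (\<Psi> l) i"
    and max_attained: "\<forall>i\<in>V. \<forall>j\<in>N i - {i}. \<forall>l\<in>LL.
        limiter_max_attained (BB l) (\<Psi> l) (\<psi>min i l) (UL i) (P i j)"
    and \<theta>1_def: "\<forall>i\<in>V. \<forall>j\<in>N i - {i}. \<forall>l\<in>LL.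
        \<theta>1 i j l = limiter_bound (BB l) (\<Psi> l) (\<psi>min i l) (UL i) (P i j)"
    and \<theta>_def: "\<forall>i\<in>V. \<forall>j\<in>N i - {i}. \<theta> i j = min (MIN l\<in>LL. \<theta>1 i j l) (MIN l\<in>LL. \<theta>1 j i l)"
    and Unew_def: "\<forall>i\<in>V. Unew i = (\<Sum>j\<in>N i - {i}. \<mu> i j *\<^sub>R (UL i + \<theta> i j *\<^sub>R P i j))"
  shows "(\<forall>i\<in>V. U i \<in> B) \<longrightarrow> (\<forall>i\<in>V. Unew i \<in> B)"
proof (intro impI ballI)
  fix i
  assume U_B: "\<forall>i\<in>V. U i \<in> B" and i: "i \<in> V"
  have finN: "finite (N k)" if "k \<in> V" for k
    using stencil(1,2) that finite_subset by blast
  have N_V: "j \<in> V" if "k \<in> V" "j \<in> N k" for j k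
    using stencil(2) that by blast
  have bar_B: "bar_state f d c U k j \<in> B" if k: "k \<in> V" and j: "j \<in> N k" for k j
  proof (cases "j = k")
    case True
    then show ?thesis using U_B k by (simp add: bar_state_def)
  next
    case False
    have d_kj: "d k j > 0"
      using d_pos k j False by blast
    have d_eq: "d k j = max (lmax (c k j /\<^sub>R norm (c k j)) (U k) (U j) * norm (c k j))
        (lmax (c j k /\<^sub>R norm (c j k)) (U j) (U k) * norm (c j k))"
      using False by (simp add: d_def low_viscosity_def)
    \<comment> \<open>By skew symmetry a vanishing \<open>c k j\<close> would make both terms of the viscosity vanish.\<close>
    have "c k j \<noteq> 0"
    proof
      assume "c k j = 0"
      moreover have "c k j = - c j k" using c_skew k j by blast
      ultimately show False using d_kj d_eq by simp
    qed
    then show ?thesis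
      using False U_B k j N_V d_kj d_eq
      by (intro bar_state_mem_invariant_set[OF system B_inv]) auto
  qed
  have source_B: "U k + (2 * \<Delta>t) *\<^sub>R S (U k) \<in> B" if "k \<in> V" for k
    using B_inv U_B that cfl(2) step unfolding invariant_set_def by auto
  have \<psi>min: "\<psi>min k l = min (\<Psi> l (U k + (2 * \<Delta>t) *\<^sub>R S (U k))) (MIN j\<in>N k. \<Psi> l (bar_state f d c U k j))"
    if "k \<in> V" "l \<in> LL" for k l
    using \<psi>min_def that by (simp add: local_min_def)
  have \<psi>min_nonneg: "\<psi>min k l \<ge> 0" if k: "k \<in> V" and l: "l \<in> LL" for k l
  proof -
    have "N k \<noteq> {}" using stencil(2) k by blast
    then show ?thesis
      using source_B[OF k] bar_B[OF k] finN[OF k] l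
      by (auto simp: \<psi>min[OF k l] B_def)
  qed
  have low: "UL k \<in> {u \<in> BB l. \<Psi> l u \<ge> \<psi>min k l}" if k: "k \<in> V" and l: "l \<in> LL" for k l
  proof (rule low_order_update_mem_convex[where U = U and i = k and s = "S (U k)" and N = "N k"
        and f = f and d = d and c = c and m = "m k" and \<Delta>t = \<Delta>t])
    show "convex {u \<in> BB l. \<Psi> l u \<ge> \<psi>min k l}"
      using \<Psi> l by (simp add: quasiconcave_on_def)
    show "U k + (2 * \<Delta>t) *\<^sub>R S (U k) \<in> {u \<in> BB l. \<Psi> l u \<ge> \<psi>min k l}"
      using source_B[OF k] l by (auto simp: \<psi>min[OF k l] B_def)
    show "bar_state f d c U k j \<in> {u \<in> BB l. \<Psi> l u \<ge> \<psi>min k l}" if j: "j \<in> N k" for j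
    proof -
      have "(MIN j\<in>N k. \<Psi> l (bar_state f d c U k j)) \<le> \<Psi> l (bar_state f d c U k j)"
        using finN[OF k] j by (intro Min_le) auto
      then show ?thesis
        using bar_B[OF k j] l by (auto simp: \<psi>min[OF k l] B_def)
    qed
    show "d k k = - (\<Sum>j\<in>N k - {k}. d k j)"
      by (simp add: d_def low_viscosity_def)
    show "1 + 4 * \<Delta>t * (d k k / m k) \<ge> 0"
      using cfl(1) stencil(1) k by (subst (asm) Min_ge_iff) auto
    show "finite (N k)" "k \<in> N k" "m k > 0" "\<Delta>t > 0" "(\<Sum>j\<in>N k. c k j) = 0"
      using k stencil(2) finN mass step c_sum by blast+
    show "d k j > 0" if "j \<in> N k - {k}" for j
      using d_pos k that by blast
    show "(m k / \<Delta>t) *\<^sub>R (UL k - U k) + (\<Sum>j\<in>N k. f (U j) *v c k j)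
        - (\<Sum>j\<in>N k - {k}. d k j *\<^sub>R (U j - U k)) = m k *\<^sub>R S (U k)"
      using low_update k by blast
  qed
  have zero_adm: "admissible_limiter (BB l) (\<Psi> l) (\<psi>min k l) (UL k) Q 0"
    if "k \<in> V" "l \<in> LL" for k l Q
    using low[OF that] by (simp add: admissible_limiter_def)
  have \<theta>1: "0 \<le> \<theta>1 k j l" "admissible_limiter (BB l) (\<Psi> l) (\<psi>min k l) (UL k) (P k j) (\<theta>1 k j l)"
    if "k \<in> V" "j \<in> N k - {k}" "l \<in> LL" for k j l
    using limiter_bound_attained[OF zero_adm[OF that(1,3)], of "P k j"] max_attained \<theta>1_def that
    by auto
  have limited: "UL i + \<theta> i j *\<^sub>R P i j \<in> {u \<in> BB l. \<Psi> l u \<ge> \<psi>min i l}"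
    if j: "j \<in> N i - {i}" and l: "l \<in> LL" for j l
  proof -
    have ji: "j \<in> V" "i \<in> N j - {j}"
      using N_V[OF i] stencil(3) i j by auto
    have "0 \<le> (MIN l\<in>LL. \<theta>1 i j l)" "0 \<le> (MIN l\<in>LL. \<theta>1 j i l)"
      using LL \<theta>1(1)[OF i j] \<theta>1(1)[OF ji] by auto
    then have "0 \<le> \<theta> i j"
      using \<theta>_def i j by simp
    have "(MIN l\<in>LL. \<theta>1 i j l) \<le> \<theta>1 i j l"
      using LL l by (intro Min_le) auto
    then have "\<theta> i j \<le> \<theta>1 i j l"
      using \<theta>_def i j by auto
    have "admissible_limiter (BB l) (\<Psi> l) (\<psi>min i l) (UL i) (P i j) (\<theta> i j)"
      using \<Psi> l by (intro admissible_limiter_downward[OF _ zero_adm[OF i l] \<theta>1(2)[OF i j l]])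
        (auto intro: \<open>0 \<le> \<theta> i j\<close> \<open>\<theta> i j \<le> \<theta>1 i j l\<close>)
    then show ?thesis
      by (simp add: admissible_limiter_def)
  qed
  have "Unew i \<in> {u \<in> BB l. \<Psi> l u \<ge> \<psi>min i l}" if l: "l \<in> LL" for l
  proof -
    have "(\<Sum>j\<in>N i - {i}. \<mu> i j *\<^sub>R (UL i + \<theta> i j *\<^sub>R P i j)) \<in> {u \<in> BB l. \<Psi> l u \<ge> \<psi>min i l}"
    proof (rule convex_sum)
      show "convex {u \<in> BB l. \<Psi> l u \<ge> \<psi>min i l}"
        using \<Psi> l by (simp add: quasiconcave_on_def)
      show "finite (N i - {i})" "(\<Sum>j\<in>N i - {i}. \<mu> i j) = 1"
        using finN[OF i] weights i by blast+
      show "\<mu> i j \<ge> 0" if "j \<in> N i - {i}" for j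
        using weights i that less_imp_le by blast
      show "UL i + \<theta> i j *\<^sub>R P i j \<in> {u \<in> BB l. \<Psi> l u \<ge> \<psi>min i l}" if "j \<in> N i - {i}" for j
        using limited that l by blast
    qed
    then show ?thesis
      using Unew_def i by simp
  qed
  then have "Unew i \<in> BB l" "\<Psi> l (Unew i) \<ge> 0" if "l \<in> LL" for l
    using \<psi>min_nonneg[OF i that] that by force+
  then show "Unew i \<in> B"
    by (simp add: B_def)
qed

end
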